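(* Let $(\Omega,g)$ be a 3-dimensional Riemannian manifold with periodic or homogeneous boundary conditions, and let $K=K[\boldsymbol{e}^1,\boldsymbol{b}^2]$ be a twice differentiable real-valued functional of $\boldsymbol{e}^1\in\Lambda^1$, $\boldsymbol{b}^2\in\Lambda^2$. Define $$H[\boldsymbol{e}^1,\boldsymbol{b}^2]=K-\Big(\boldsymbol{e}^1,\frac{\delta K}{\delta\boldsymbol{e}^1}\Big)+\frac1{8\pi}\Big[(\boldsymbol{e}^1,\boldsymbol{e}^1)+(\boldsymbol{b}^2,\boldsymbol{b}^2)\Big],$$ $$\tilde{\boldsymbol{d}}^2=\star\boldsymbol{e}^1-4\pi\frac{\tilde\delta K}{\delta\boldsymbol{e}^1},\qquad\tilde{\boldsymbol{h}}^1=\star\boldsymbol{b}^2+4\pi\frac{\tilde\delta K}{\delta\boldsymbol{b}^2},$$ and assume that $(\boldsymbol{e}^1,\boldsymbol{b}^2)\mapsto(\tilde{\boldsymbol{d}}^2,\boldsymbol{b}^2)$ is a diffeomorphism. Define $\overline H$ by $\overline H[\tilde{\boldsymbol{d}}^2,\boldsymbol{b}^2]=H[\boldsymbol{e}^1,\boldsymbol{b}^2]$. Then $$\frac{\tilde\delta\overline H}{\delta\tilde{\boldsymbol{d}}^2}=\frac{\boldsymbol{e}^1}{4\pi}\qquad\text{and}\qquad\frac{\tilde\delta\overline H}{\delta\boldsymbol{b}^2}=\frac{\star\boldsymbol{b}^2}{4\pi}+\frac{\tilde\delta K}{\delta\boldsymbol{b}^2}=\frac{\tilde{\boldsymbol{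h}}^1}{4\pi}.$$
   Context: $\Lambda^k$ denotes straight differential $k$-forms on $\Omega$ and $\tilde\Lambda^k$ twisted $k$-forms (which additionally change sign under orientation-reversing coordinate changes). $(\omega,\eta)=\int_\Omega g_x(\omega,\eta)\,\mathrm{vol}^3$ is the $L^2$ inner product on $k$-forms, $\langle\omega^k,\tilde\eta^{3-k}\rangle=\int_\Omega\omega^k\wedge\tilde\eta^{3-k}$ is the Poincaré pairing of straight and twisted forms, and the Hodge star $\star:\Lambda^k\to\tilde\Lambda^{3-k}$ is defined by $(\omega,\eta)=\langle\omega,\star\eta\rangle$. Functional derivatives: for $K$ a functional of a straight $k$-form $\omega$ (other arguments fixed), $DK[\omega]\eta=(\eta,\frac{\delta K}{\delta\omega})=\langle\eta,\frac{\tilde\delta K}{\delta\omega}\rangle$, so $\frac{\delta K}{\delta\omega}\in\Lambda^k$ and $\frac{\tilde\delta K}{\delta\omega}=\star\frac{\delta K}{\delta\omega}\in\tilde\Lambda^{3-k}$. For a functional of a twisted $k$-form $\tilde\omega$, $\frac{\tilde\delta K}{\delta\tilde\omega}\in\Lambda^{3-k}$ is defined by $DK[\tilde\omega]\tilde\eta=\langle\frac{\tilde\delta K}{\delta\tilde\omega},\tilde\eta\rangle$. In $\overline H$, the derivative with respect to $\tilde{\boldsymbol{d}}^2$ is taken at fixed $\boldsymbol{b}^2$ and vice versa. All functional derivatives (first and second) are assumed to exist and to be sufficiently regular. *)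

theory Defs
  imports "HOL-Analysis.Analysis" "HOL-Combinatorics.Permutations"
begin

section \<open>Smooth functions on relatively open subsets of a half-space\<close>

definition half_space :: "(real^3) set" where
  "half_space = {x. x $ 3 \<ge> 0}"

text \<open>Iterated partial derivatives. Derivatives are taken within the set \<open>S\<close>, so that they are
  one-sided at boundary points of the half-space; \<open>S\<close> will always be relatively open in
  the half-space, where such derivatives are unique.\<close>

fun partials :: "(real^3) set \<Rightarrow> 3 list \<Rightarrow> (real^3 \<Rightarrow> real) \<Rightarrow> (real^3 \<Rightarrow> real)" where
  "partials S [] f = f"
| "partials S (i # js) f =
     (\<lambda>x. frechet_derivative (partials S js f) (at x within S) (axis i 1))"

definition smooth_on :: "(real^3) set \<Rightarrow> (real^3 \<Rightarrow> real) \<Rightarrow> bool" where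
  "smooth_on S f \<longleftrightarrow> (\<forall>js. partials S js f differentiable_on S)"


section \<open>Riemannian 3-manifolds, possibly with boundary\<close>

type_synonym 'a chart = "'a set \<times> ('a \<Rightarrow> real^3)"

abbreviation dom_of :: "'a chart \<Rightarrow> 'a set" where "dom_of c \<equiv> fst c"
abbreviation coord :: "'a chart \<Rightarrow> 'a \<Rightarrow> real^3" where "coord c \<equiv> snd c"

definition coord_inv :: "'a chart \<Rightarrow> real^3 \<Rightarrow> 'a" where
  "coord_inv c = inv_into (dom_of c) (coord c)"

definition range_of :: "'a chart \<Rightarrow> (real^3) set" where
  "range_of c = coord c ` dom_of c"

text \<open>\<open>metric M c p\<close> is the Gram matrix of the metric at the point \<open>p\<close> in the chart \<open>c\<close>.\<close>

record 'a riemannian =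
  points :: "'a set"
  charts :: "'a chart set"
  metric :: "'a chart \<Rightarrow> 'a \<Rightarrow> real^3^3"

definition jacobian :: "'a chart \<Rightarrow> 'a chart \<Rightarrow> 'a \<Rightarrow> real^3 \<Rightarrow> real^3" where
  "jacobian c c' p = frechet_derivative (\<lambda>x. coord c' (coord_inv c x))
     (at (coord c p) within coord c ` (dom_of c \<inter> dom_of c'))"

definition smooth_manifold3 :: "'a::{t2_space,second_countable_topology} set \<Rightarrow> 'a chart set \<Rightarrow> bool" where
  "smooth_manifold3 \<Omega> A \<longleftrightarrow>
     \<Omega> \<noteq> {} \<and> (\<Union>c\<in>A. dom_of c) = \<Omega> \<and>
     (\<forall>c\<in>A. openin (top_of_set \<Omega>) (dom_of c) \<and>
            openin (top_of_set half_space) (range_of c) \<and>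
            homeomorphism (dom_of c) (range_of c) (coord c) (coord_inv c)) \<and>
     (\<forall>c\<in>A. \<forall>c'\<in>A. \<forall>i. smooth_on (coord c ` (dom_of c \<inter> dom_of c'))
                             (\<lambda>x. coord c' (coord_inv c x) $ i))"

definition riemannian_manifold3 :: "'a::{t2_space,second_countable_topology} riemannian \<Rightarrow> bool" where
  "riemannian_manifold3 M \<longleftrightarrow>
     smooth_manifold3 (points M) (charts M) \<and>
     (\<forall>c\<in>charts M. \<forall>p\<in>dom_of c.
        transpose (metric M c p) = metric M c p \<and>
        (\<forall>v. v \<noteq> 0 \<longrightarrow> v \<bullet> (metric M c p *v v) > 0)) \<and>
     (\<forall>c\<in>charts M. \<forall>c'\<in>charts M. \<forall>p\<in>dom_of c \<inter> dom_of c'.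
        metric M c p = transpose (matrix (jacobian c c' p)) ** metric M c' p ** matrix (jacobian c c' p)) \<and>
     (\<forall>c\<in>charts M. \<forall>i j. smooth_on (range_of c) (\<lambda>x. metric M c (coord_inv c x) $ i $ j))"

definition boundary_points :: "'a riemannian \<Rightarrow> 'a set" where
  "boundary_points M = {p. \<exists>c\<in>charts M. p \<in> dom_of c \<and> coord c p $ 3 = 0}"


section \<open>Straight and twisted differential forms\<close>

text \<open>A form assigns to a chart, a point and a list of vectors (given by their coordinates in that
  chart) a real number. The type contains arbitrary such assignments, so as to carry the pointwise
  vector space structure; actual forms are singled out by \<open>smooth_forms\<close> below.\<close>

typedef 'a form = "UNIV :: ('a chart \<Rightarrow> 'a \<Rightarrow> (real^3) list \<Rightarrow> real) set"
  morphisms at_chart Form ..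

lemma at_chart_Form [simp]: "at_chart (Form f) = f"
  by (simp add: Form_inverse)

lemma form_eqI: "(\<And>c p vs. at_chart \<alpha> c p vs = at_chart \<beta> c p vs) \<Longrightarrow> \<alpha> = \<beta>"
  by (simp add: at_chart_inject[symmetric] fun_eq_iff)

instantiation form :: (type) real_vector
begin

definition "0 = Form (\<lambda>c p vs. 0)"
definition "\<alpha> + \<beta> = Form (\<lambda>c p vs. at_chart \<alpha> c p vs + at_chart \<beta> c p vs)"
definition "- \<alpha> = Form (\<lambda>c p vs. - at_chart \<alpha> c p vs)"
definition "\<alpha> - \<beta> = Form (\<lambda>c p vs. at_chart \<alpha> c p vs - at_chart \<beta> c p vs)"
definition "r *\<^sub>R \<alpha> = Form (\<lambda>c p vs. r * at_chart \<alpha> c p vs)"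

instance
  by standard
    (auto intro!: form_eqI simp: zero_form_def plus_form_def uminus_form_def minus_form_def
       scaleR_form_def algebra_simps)

end

definition alternating :: "nat \<Rightarrow> ((real^3) list \<Rightarrow> real) \<Rightarrow> bool" where
  "alternating k \<alpha> \<longleftrightarrow>
     (\<forall>vs. length vs \<noteq> k \<longrightarrow> \<alpha> vs = 0) \<and>
     (\<forall>vs i. length vs = k \<and> i < k \<longrightarrow> linear (\<lambda>v. \<alpha> (vs[i := v]))) \<and>
     (\<forall>vs i j. length vs = k \<and> i < j \<and> j < k \<and> vs ! i = vs ! j \<longrightarrow> \<alpha> vs = 0)"

definition component :: "'a form \<Rightarrow> 'a chart \<Rightarrow> 3 list \<Rightarrow> real^3 \<Rightarrow> real" where
  "component \<omega> c is x = at_chart \<omega> c (coord_inv c x) (map (\<lambda>i. axis i 1) is)"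

definition supported_in :: "'a set \<Rightarrow> 'a form \<Rightarrow> bool" where
  "supported_in C \<omega> \<longleftrightarrow> (\<forall>c p vs. p \<notin> C \<longrightarrow> at_chart \<omega> c p vs = 0)"

datatype parity = Straight | Twisted

text \<open>Smooth \<open>k\<close>-forms of compact support (automatic when the manifold is compact). The support may
  meet the boundary. The first conjunct fixes the irrelevant values, so that equality of forms is
  equality of functions.\<close>

definition smooth_forms :: "'a::{t2_space,second_countable_topology} riemannian \<Rightarrow> parity \<Rightarrow> nat \<Rightarrow> 'a form set" where
  "smooth_forms M tw k = {\<omega>.
     (\<forall>c p vs. c \<notin> charts M \<or> p \<notin> dom_of c \<longrightarrow> at_chart \<omega> c p vs = 0) \<and>
     (\<forall>c\<in>charts M. \<forall>p\<in>dom_of c. alternating k (at_chart \<omega> c p)) \<and>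
     (\<forall>c\<in>charts M. \<forall>c'\<in>charts M. \<forall>p\<in>dom_of c \<inter> dom_of c'. \<forall>vs.
        at_chart \<omega> c p vs =
          (case tw of Straight \<Rightarrow> 1 | Twisted \<Rightarrow> sgn (det (matrix (jacobian c c' p)))) *
          at_chart \<omega> c' p (map (jacobian c c' p) vs)) \<and>
     (\<forall>c\<in>charts M. \<forall>is. length is = k \<longrightarrow> smooth_on (range_of c) (component \<omega> c is)) \<and>
     (\<exists>C. compact C \<and> C \<subseteq> points M \<and> supported_in C \<omega>)}"

text \<open>A linear homogeneous boundary condition: a linear space of forms, membership in which depends
  only on the behaviour of a form near the boundary. If the boundary is empty, which is how
  periodic conditions arise (e.g. on a flat torus), the only such space consists of all forms.\<close>

definition boundary_condition ::
  "'a::{t2_space,second_countable_topology} riemannian \<Rightarrow> parity \<Rightarrow> nat \<Rightarrow> 'a form set \<Rightarrow> bool" where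
  "boundary_condition M tw k X \<longleftrightarrow>
     X \<subseteq> smooth_forms M tw k \<and> subspace X \<and>
     (\<forall>\<omega>\<in>X. \<forall>\<eta>\<in>smooth_forms M tw k. \<forall>N.
        openin (top_of_set (points M)) N \<and> boundary_points M \<subseteq> N \<and>
        (\<forall>c. \<forall>p\<in>N. at_chart \<eta> c p = at_chart \<omega> c p) \<longrightarrow> \<eta> \<in> X)"


section \<open>Inner product, wedge product, integration\<close>

text \<open>Inner product of \<open>k\<close>-covectors for the Gram matrix \<open>G\<close>: all indices of \<open>\<beta>\<close> are raised with the
  inverse of \<open>G\<close> and contracted with those of \<open>\<alpha>\<close>; dividing by \<open>k!\<close> amounts to summing over increasing
  index tuples only.\<close>

definition covector_inner ::
  "nat \<Rightarrow> real^3^3 \<Rightarrow> ((real^3) list \<Rightarrow> real) \<Rightarrow> ((real^3) list \<Rightarrow> real) \<Rightarrow> real" where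
  "covector_inner k G \<alpha> \<beta> =
     (\<Sum>is\<in>{is :: 3 list. length is = k}. \<Sum>js\<in>{js :: 3 list. length js = k}.
        (\<Prod>m<k. matrix_inv G $ (is ! m) $ (js ! m)) *
        \<alpha> (map (\<lambda>i. axis i 1) is) * \<beta> (map (\<lambda>j. axis j 1) js)) / fact k"

definition wedge :: "nat \<Rightarrow> nat \<Rightarrow> 'a form \<Rightarrow> 'a form \<Rightarrow> 'a form" where
  "wedge k l \<omega> \<eta> = Form (\<lambda>c p vs.
     if length vs = k + l then
       (\<Sum>\<sigma> | \<sigma> permutes {..<k + l}. of_int (sign \<sigma>) *
          at_chart \<omega> c p (map (\<lambda>i. vs ! \<sigma> i) [0..<k]) *
          at_chart \<eta> c p (map (\<lambda>i. vs ! \<sigma> i) [k..<k + l])) / (fact k * fact l)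
     else 0)"

text \<open>The twisted 3-form \<open>g\<^sub>x(\<omega>,\<eta>) vol\<^sup>3\<close>; in coordinates, \<open>vol\<^sup>3\<close> is \<open>sqrt (det G)\<close> times the
  standard volume form.\<close>

definition inner_vol :: "'a riemannian \<Rightarrow> nat \<Rightarrow> 'a form \<Rightarrow> 'a form \<Rightarrow> 'a form" where
  "inner_vol M k \<omega> \<eta> = Form (\<lambda>c p vs.
     if length vs = 3 then
       covector_inner k (metric M c p) (at_chart \<omega> c p) (at_chart \<eta> c p) *
       (sqrt (det (metric M c p)) * det (vector [vs ! 0, vs ! 1, vs ! 2] :: real^3^3))
     else 0)"

text \<open>Integration of compactly supported twisted 3-forms: the manifold is cut into disjoint Borel
  pieces, each relatively compact in a chart, and the coordinate expression is integrated over each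
  piece. The pieces are \<open>C\<^sub>n - (C\<^sub>0 \<union> \<dots> \<union> C\<^sub>n\<^sub>-\<^sub>1)\<close> for compact sets \<open>C\<^sub>n\<close> whose interiors cover the
  manifold, so a compact support meets only finitely many of them. By the change of variables
  formula the value does not depend on the choice, since the components of twisted 3-forms transform
  with the absolute value of the Jacobian determinant.\<close>

definition chart_cover ::
  "'a::{t2_space,second_countable_topology} riemannian \<Rightarrow> (nat \<Rightarrow> 'a chart) \<Rightarrow> (nat \<Rightarrow> 'a set) \<Rightarrow> bool" where
  "chart_cover M c C \<longleftrightarrow>
     (\<forall>n. c n \<in> charts M \<and> compact (C n) \<and> C n \<subseteq> dom_of (c n)) \<and>
     (\<forall>p\<in>points M. \<exists>n N. openin (top_of_set (points M)) N \<and> p \<in> N \<and> N \<subseteq> C n)"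

definition form_integral :: "'a::{t2_space,second_countable_topology} riemannian \<Rightarrow> 'a form \<Rightarrow> real" where
  "form_integral M \<mu> =
     (let (c, C) = (SOME (c, C). chart_cover M c C) in
      \<Sum>n. LINT x : coord (c n) ` (C n - (\<Union>m<n. C m)) | lborel. component \<mu> (c n) [1, 2, 3] x)"

definition L2_inner ::
  "'a::{t2_space,second_countable_topology} riemannian \<Rightarrow> nat \<Rightarrow> 'a form \<Rightarrow> 'a form \<Rightarrow> real" where
  "L2_inner M k \<omega> \<eta> = form_integral M (inner_vol M k \<omega> \<eta>)"

definition poincare_pairing ::
  "'a::{t2_space,second_countable_topology} riemannian \<Rightarrow> nat \<Rightarrow> 'a form \<Rightarrow> 'a form \<Rightarrow> real" where
  "poincare_pairing M k \<omega> \<eta> = form_integral M (wedge k (3 - k) \<omega> \<eta>)"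

text \<open>\<open>V k\<close> and \<open>W k\<close> are the spaces of straight and twisted \<open>k\<close>-forms. The defining identity
  determines \<open>star k \<eta>\<close> uniquely, because \<open>V k\<close> contains all forms supported in the interior.\<close>

definition is_hodge_star ::
  "'a::{t2_space,second_countable_topology} riemannian \<Rightarrow> (nat \<Rightarrow> 'a form set) \<Rightarrow> (nat \<Rightarrow> 'a form set) \<Rightarrow>
     (nat \<Rightarrow> 'a form \<Rightarrow> 'a form) \<Rightarrow> bool" where
  "is_hodge_star M V W star \<longleftrightarrow>
     (\<forall>k\<le>3. \<forall>\<eta>\<in>V k. star k \<eta> \<in> W (3 - k) \<and>
        (\<forall>\<omega>\<in>V k. L2_inner M k \<omega> \<eta> = poincare_pairing M k \<omega> (star k \<eta>)))"


section \<open>Calculus on spaces of forms\<close>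

text \<open>Convergence of sequences in the usual topology of smooth forms of compact support: the supports
  stay in a fixed compact set and all derivatives of all components converge uniformly on compact
  subsets of the charts.\<close>

definition form_lim ::
  "'a::{t2_space,second_countable_topology} riemannian \<Rightarrow> nat \<Rightarrow> (nat \<Rightarrow> 'a form) \<Rightarrow> 'a form \<Rightarrow> bool" where
  "form_lim M k f \<omega> \<longleftrightarrow>
     (\<exists>C. compact C \<and> C \<subseteq> points M \<and> (\<forall>n. supported_in C (f n))) \<and>
     (\<forall>c\<in>charts M. \<forall>C. compact C \<and> C \<subseteq> dom_of c \<longrightarrow>
        (\<forall>is js. length is = k \<longrightarrow>
           uniform_limit (coord c ` C) (\<lambda>n. partials (range_of c) js (component (f n) c is))
             (partials (range_of c) js (component \<omega> c is)) sequentially))"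

text \<open>A linear subspace of a real vector space together with its convergent sequences.\<close>

type_synonym 'x lim_space = "'x set \<times> ((nat \<Rightarrow> 'x) \<Rightarrow> 'x \<Rightarrow> bool)"

definition real_space :: "real lim_space" where
  "real_space = (UNIV, \<lambda>f x. f \<longlonglongrightarrow> x)"

definition form_space ::
  "'a::{t2_space,second_countable_topology} riemannian \<Rightarrow> nat \<Rightarrow> 'a form set \<Rightarrow> 'a form lim_space" where
  "form_space M k X = (X, form_lim M k)"

definition prod_space :: "'x lim_space \<Rightarrow> 'y lim_space \<Rightarrow> ('x \<times> 'y) lim_space" where
  "prod_space X Y = (fst X \<times> fst Y,
     \<lambda>f x. snd X (\<lambda>n. fst (f n)) (fst x) \<and> snd Y (\<lambda>n. snd (f n)) (snd x))"

text \<open>Hadamard (compact) differentiability, the weakest standard notion beyond normed spaces for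
  which the chain rule holds; on normed spaces it is implied by Frechet differentiability.\<close>

definition has_deriv ::
  "'x::real_vector lim_space \<Rightarrow> 'y::real_vector lim_space \<Rightarrow> ('x \<Rightarrow> 'y) \<Rightarrow> ('x \<Rightarrow> 'y) \<Rightarrow> 'x \<Rightarrow> bool" where
  "has_deriv X Y F D x \<longleftrightarrow>
     (\<forall>u\<in>fst X. D u \<in> fst Y) \<and>
     (\<forall>u\<in>fst X. \<forall>v\<in>fst X. D (u + v) = D u + D v) \<and>
     (\<forall>r. \<forall>u\<in>fst X. D (r *\<^sub>R u) = r *\<^sub>R D u) \<and>
     (\<forall>t v w. (\<forall>n. t n \<noteq> 0) \<and> t \<longlonglongrightarrow> 0 \<and> (\<forall>n. v n \<in> fst X) \<and> w \<in> fst X \<and> snd X v w \<longrightarrow>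
        snd Y (\<lambda>n. (F (x + t n *\<^sub>R v n) - F x) /\<^sub>R t n) (D w))"

definition differentiable_map ::
  "'x::real_vector lim_space \<Rightarrow> 'y::real_vector lim_space \<Rightarrow> ('x \<Rightarrow> 'y) \<Rightarrow> bool" where
  "differentiable_map X Y F \<longleftrightarrow>
     (\<forall>x\<in>fst X. F x \<in> fst Y) \<and> (\<forall>x\<in>fst X. \<exists>D. has_deriv X Y F D x)"

definition diffeomorphism ::
  "'x::real_vector lim_space \<Rightarrow> 'y::real_vector lim_space \<Rightarrow> ('x \<Rightarrow> 'y) \<Rightarrow> bool" where
  "diffeomorphism X Y F \<longleftrightarrow>
     bij_betw F (fst X) (fst Y) \<and> differentiable_map X Y F \<and>
     differentiable_map Y X (inv_into (fst X) F)"

text \<open>\<open>\<delta>F/\<delta>\<omega> = \<delta>\<close> for a functional of a straight \<open>k\<close>-form.\<close>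

definition has_fun_deriv ::
  "'a::{t2_space,second_countable_topology} riemannian \<Rightarrow> (nat \<Rightarrow> 'a form set) \<Rightarrow> nat \<Rightarrow>
     ('a form \<Rightarrow> real) \<Rightarrow> 'a form \<Rightarrow> 'a form \<Rightarrow> bool" where
  "has_fun_deriv M V k F \<delta> \<omega> \<longleftrightarrow>
     \<delta> \<in> V k \<and> has_deriv (form_space M k (V k)) real_space F (\<lambda>\<eta>. L2_inner M k \<eta> \<delta>) \<omega>"

text \<open>The twisted derivative of a functional of a straight \<open>k\<close>-form is a twisted \<open>(3-k)\<close>-form.\<close>

definition has_tw_fun_deriv_straight ::
  "'a::{t2_space,second_countable_topology} riemannian \<Rightarrow> (nat \<Rightarrow> 'a form set) \<Rightarrow> (nat \<Rightarrow> 'a form set) \<Rightarrow>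
     nat \<Rightarrow> ('a form \<Rightarrow> real) \<Rightarrow> 'a form \<Rightarrow> 'a form \<Rightarrow> bool" where
  "has_tw_fun_deriv_straight M V W k F \<delta> \<omega> \<longleftrightarrow>
     \<delta> \<in> W (3 - k) \<and>
     has_deriv (form_space M k (V k)) real_space F (\<lambda>\<eta>. poincare_pairing M k \<eta> \<delta>) \<omega>"

text \<open>The twisted derivative of a functional of a twisted \<open>k\<close>-form is a straight \<open>(3-k)\<close>-form.\<close>

definition has_tw_fun_deriv_twisted ::
  "'a::{t2_space,second_countable_topology} riemannian \<Rightarrow> (nat \<Rightarrow> 'a form set) \<Rightarrow> (nat \<Rightarrow> 'a form set) \<Rightarrow>
     nat \<Rightarrow> ('a form \<Rightarrow> real) \<Rightarrow> 'a form \<Rightarrow> 'a form \<Rightarrow> bool" where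
  "has_tw_fun_deriv_twisted M V W k F \<delta> \<omega> \<longleftrightarrow>
     \<delta> \<in> V (3 - k) \<and>
     has_deriv (form_space M k (W k)) real_space F (\<lambda>\<eta>. poincare_pairing M (3 - k) \<delta> \<eta>) \<omega>"

end

theory Submission
  imports Defs
begin

text \<open>The statement is a Legendre transform. Along a curve with velocity \<open>(w, \<beta>)\<close> in the variables
  \<open>(d, b)\<close>, let \<open>v\<close> be the velocity of \<open>e\<close> (it exists because the change of variables is a
  diffeomorphism) and \<open>\<kappa>\<close> that of \<open>\<delta>K/\<delta>e\<close>. Pairing the definition of \<open>d\<close> with \<open>e\<close> gives
  \<open>\<langle>e, w\<rangle> = (e, v) - 4\<pi> (e, \<kappa>)\<close>. In the derivative of \<open>H\<close> the terms \<open>(v, \<delta>K/\<delta>e)\<close> cancel, and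
  \<open>(e, v) / 4\<pi> - (e, \<kappa>)\<close> is exactly \<open>\<langle>e, w\<rangle> / 4\<pi>\<close>; the rest is linear in \<open>\<beta>\<close>. To pass to the limit one
  needs the inner product and the pairing to be bilinear and jointly sequentially continuous: a compact
  support meets only finitely many pieces of the chart cover that defines the integral, and on each
  piece the integrands converge uniformly.\<close>

subsection \<open>Integration of forms\<close>

locale riemannian3 =
  fixes M :: "'a::{t2_space,second_countable_topology} riemannian"
  assumes riemannian: "riemannian_manifold3 M"
begin

section \<open>Charts, compact neighbourhoods and chart covers\<close>

lemma chart_properties:
  assumes "c \<in> charts M"
  shows openin_dom: "openin (top_of_set (points M)) (dom_of c)"
    and openin_range: "openin (top_of_set half_space) (range_of c)"
    and chart_homeomorphism: "homeomorphism (dom_of c) (range_of c) (coord c) (coord_inv c)"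
  using riemannian assms unfolding riemannian_manifold3_def smooth_manifold3_def by blast+

lemma coord_inv_coord: "c \<in> charts M \<Longrightarrow> p \<in> dom_of c \<Longrightarrow> coord_inv c (coord c p) = p"
  using chart_homeomorphism by (auto simp: homeomorphism_def)

lemma coord_inv_in_dom: "c \<in> charts M \<Longrightarrow> x \<in> range_of c \<Longrightarrow> coord_inv c x \<in> dom_of c"
  using chart_homeomorphism by (fastforce simp: homeomorphism_def)

lemma compact_coord_image:
  "c \<in> charts M \<Longrightarrow> compact C \<Longrightarrow> C \<subseteq> dom_of c \<Longrightarrow> compact (coord c ` C)"
  using homeomorphism_cont1[OF chart_homeomorphism]
  by (metis compact_continuous_image continuous_on_subset)

text \<open>A small closed ball around the coordinates of \<open>p\<close> meets the half-space in a
  compact set, also when \<open>p\<close> lies on the boundary, and relative openness of the chart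
  range puts this set inside the range. Its image under \<open>coord_inv c\<close> is
  \<open>C\<close>; the open ball gives \<open>N\<close>.\<close>

lemma compact_chart_neighbourhood:
  assumes "p \<in> points M"
  obtains c N C where "c \<in> charts M" "openin (top_of_set (points M)) N" "p \<in> N" "N \<subseteq> C"
    "compact C" "C \<subseteq> dom_of c"
proof -
  obtain c where c: "c \<in> charts M" and p: "p \<in> dom_of c"
    using riemannian assms unfolding riemannian_manifold3_def smooth_manifold3_def by blast
  have hom: "homeomorphism (range_of c) (dom_of c) (coord_inv c) (coord c)"
    using chart_homeomorphism[OF c] by (rule homeomorphism_symD)
  have x: "coord c p \<in> range_of c" using p by (auto simp: range_of_def)
  obtain r where r: "r > 0" "cball (coord c p) r \<inter> half_space \<subseteq> range_of c"
    using openin_range[OF c] x unfolding openin_contains_cball by blast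
  have "closed half_space"
    unfolding half_space_def by (intro closed_Collect_le continuous_intros)
  then have K: "compact (cball (coord c p) r \<inter> half_space)" by (simp add: compact_Int_closed)
  let ?N = "coord_inv c ` (ball (coord c p) r \<inter> half_space)"
  let ?C = "coord_inv c ` (cball (coord c p) r \<inter> half_space)"
  have sub: "range_of c \<subseteq> half_space" using openin_range[OF c] openin_imp_subset by blast
  have "ball (coord c p) r \<inter> half_space = range_of c \<inter> ball (coord c p) r"
    using r sub by auto
  then have "openin (top_of_set (range_of c)) (ball (coord c p) r \<inter> half_space)"
    by (simp add: openin_open_Int)
  then have "openin (top_of_set (dom_of c)) ?N"
    using homeomorphism_imp_open_map[OF hom] by blast
  then have N: "openin (top_of_set (points M)) ?N"
    using openin_trans openin_dom[OF c] by blast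
  have "coord c p \<in> ball (coord c p) r \<inter> half_space" using r x sub by auto
  then have pN: "p \<in> ?N" using coord_inv_coord[OF c p] by force
  have C: "compact ?C"
    using K r hom
    by (auto simp: homeomorphism_def intro!: compact_continuous_image intro: continuous_on_subset)
  have "?C \<subseteq> dom_of c" using r coord_inv_in_dom[OF c] by blast
  moreover have "?N \<subseteq> ?C" by (intro image_mono) auto
  ultimately show ?thesis using that c N pN C by blast
qed

text \<open>\<open>form_integral\<close> picks its cover with \<open>SOME\<close>, so existence
  comes before any property of the integral. By Lindelof's theorem, countably many open sets with a
  compact hull inside a chart already cover the manifold.\<close>

lemma chart_cover_exists: "\<exists>c C. chart_cover M c C"
proof -
  define \<F> where "\<F> = {N. openin (top_of_set (points M)) N \<and>
    (\<exists>c\<in>charts M. \<exists>C. N \<subseteq> C \<and> compact C \<and> C \<subseteq> dom_of c)}"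
  have "openin (top_of_set (points M)) N" if "N \<in> \<F>" for N
    using that by (simp add: \<F>_def)
  then obtain \<G> where \<G>: "\<G> \<subseteq> \<F>" "countable \<G>" "\<Union>\<G> = \<Union>\<F>"
    by (rule Lindelof_openin)
  have cover: "points M \<subseteq> \<Union>\<F>"
  proof
    fix p assume "p \<in> points M"
    then obtain c N C where N: "c \<in> charts M" "openin (top_of_set (points M)) N" "p \<in> N" "N \<subseteq> C"
      "compact C" "C \<subseteq> dom_of c"
      by (rule compact_chart_neighbourhood)
    have "N \<in> \<F>"
      unfolding \<F>_def using N(2) by (intro CollectI conjI bexI[OF _ N(1)] exI[of _ C] N(4-6))
    with N(3) show "p \<in> \<Union>\<F>" by (rule UnionI[rotated])
  qed
  have "points M \<noteq> {}"
    using riemannian unfolding riemannian_manifold3_def smooth_manifold3_def by blast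
  then have ne: "\<G> \<noteq> {}" using \<G>(3) cover by (metis Union_empty subset_empty)
  \<comment> \<open>\<open>from_nat_into\<close> enumerates a nonempty countable set, with
    repetitions if it is finite, which a \<open>chart_cover\<close> allows.\<close>
  define N where "N = from_nat_into \<G>"
  have N: "N n \<in> \<F>" for n using from_nat_into[OF ne] \<G> by (auto simp: N_def)
  then have "\<forall>n. \<exists>c C. c \<in> charts M \<and> N n \<subseteq> C \<and> compact C \<and> C \<subseteq> dom_of c"
    unfolding \<F>_def by blast
  then obtain c C where cC: "\<And>n. c n \<in> charts M \<and> N n \<subseteq> C n \<and> compact (C n) \<and> C n \<subseteq> dom_of (c n)"
    by metis
  have "\<exists>n N. openin (top_of_set (points M)) N \<and> p \<in> N \<and> N \<subseteq> C n" if "p \<in> points M" for p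
  proof -
    have "p \<in> \<Union>\<G>" using that cover \<G> by auto
    also have "\<G> = range N" unfolding N_def using range_from_nat_into[OF ne] \<G> by simp
    finally obtain n where "p \<in> N n" by auto
    moreover have "openin (top_of_set (points M)) (N n)" using N[of n] by (simp add: \<F>_def)
    ultimately show ?thesis using cC by metis
  qed
  then show ?thesis using cC by (intro exI[of _ c] exI[of _ C]) (simp add: chart_cover_def)
qed

text \<open>Finitely many \<open>C n\<close> cover the compact set \<open>Q\<close>, and later
  pieces avoid them, so their terms vanish. The cover and the bound \<open>N\<close> depend on
  \<open>Q\<close> alone: all forms supported in \<open>Q\<close> are integrated by one finite sum,
  and linearity and limits can be checked term by term.\<close>

lemma form_integral_finite_sum:
  assumes Q: "compact Q" "Q \<subseteq> points M"
  shows "\<exists>c C N. chart_cover M c C \<and> (\<forall>\<mu>. supported_in Q \<mu> \<longrightarrow> form_integral M \<mu> =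
      (\<Sum>n<N. LINT x : coord (c n) ` (C n - (\<Union>m<n. C m)) | lborel. component \<mu> (c n) [1, 2, 3] x))"
proof -
  obtain c C where eq: "(SOME (c, C). chart_cover M c C) = (c, C)" by fastforce
  have "case (SOME (c, C). chart_cover M c C) of (c, C) \<Rightarrow> chart_cover M c C"
    by (rule someI_ex) (use chart_cover_exists in auto)
  then have cC: "chart_cover M c C" by (simp add: eq)
  \<comment> \<open>The neighbourhoods in \<open>chart_cover\<close> are open relative to the
    manifold; the members of \<U> are open in the ambient space, as compactness of \<open>Q\<close>
    requires.\<close>
  define \<U> where "\<U> = {U. open U \<and> (\<exists>n. points M \<inter> U \<subseteq> C n)}"
  have "Q \<subseteq> \<Union>\<U>"
  proof
    fix p assume "p \<in> Q"
    then obtain n N where "openin (top_of_set (points M)) N" "p \<in> N" "N \<subseteq> C n"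
      using cC Q unfolding chart_cover_def by blast
    then show "p \<in> \<Union>\<U>" unfolding openin_open \<U>_def by blast
  qed
  moreover have "open U" if "U \<in> \<U>" for U using that by (simp add: \<U>_def)
  ultimately obtain \<D> where D: "\<D> \<subseteq> \<U>" "finite \<D>" "Q \<subseteq> \<Union>\<D>"
    using compactE[OF Q(1)] by metis
  have "\<forall>U\<in>\<D>. \<exists>n. points M \<inter> U \<subseteq> C n" using D by (auto simp: \<U>_def)
  then obtain n where n: "\<forall>U\<in>\<D>. points M \<inter> U \<subseteq> C (n U)"
    by (rule bchoice[THEN exE])
  \<comment> \<open>\<open>Suc\<close> makes \<open>N\<close> a strict bound, and inserting 0 keeps
    \<open>Max\<close> meaningful when \<D> is empty.\<close>
  define N where "N = Suc (Max (insert 0 (n ` \<D>)))"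
  have nN: "n U < N" if "U \<in> \<D>" for U
    using that D by (simp add: N_def le_imp_less_Suc)
  have QN: "Q \<subseteq> (\<Union>m<N. C m)"
  proof
    fix p assume "p \<in> Q"
    with D Q obtain U where "U \<in> \<D>" "p \<in> points M \<inter> U" by blast
    with n have "p \<in> C (n U)" by blast
    with nN[OF \<open>U \<in> \<D>\<close>] show "p \<in> (\<Union>m<N. C m)" by blast
  qed
  have sum_eq: "form_integral M \<mu> =
      (\<Sum>n<N. LINT x : coord (c n) ` (C n - (\<Union>m<n. C m)) | lborel. component \<mu> (c n) [1, 2, 3] x)"
    if \<mu>: "supported_in Q \<mu>" for \<mu>
  proof -
    have zero: "(LINT x : coord (c n) ` (C n - (\<Union>m<n. C m)) | lborel. component \<mu> (c n) [1, 2, 3] x) = 0"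
      if "n \<ge> N" for n
    proof -
      have "component \<mu> (c n) [1, 2, 3] x = 0" if x: "x \<in> coord (c n) ` (C n - (\<Union>m<n. C m))" for x
      proof -
        obtain p where p: "p \<in> C n" "p \<notin> (\<Union>m<n. C m)" "x = coord (c n) p" using x by auto
        have "coord_inv (c n) x = p"
          using p cC coord_inv_coord[of "c n" p] unfolding chart_cover_def by blast
        moreover have "p \<notin> (\<Union>m<N. C m)" using p(2) \<open>n \<ge> N\<close> by (metis UN_iff lessThan_iff less_le_trans)
        then have "p \<notin> Q" using QN by (rule contra_subsetD[rotated])
        ultimately show ?thesis using \<mu> unfolding component_def supported_in_def by metis
      qed
      then have *: "indicat_real (coord (c n) ` (C n - (\<Union>m<n. C m))) x *\<^sub>R component \<mu> (c n) [1, 2, 3] x = 0"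
        for x by (cases "x \<in> coord (c n) ` (C n - (\<Union>m<n. C m))") simp_all
      show ?thesis unfolding set_lebesgue_integral_def * by simp
    qed
    show ?thesis
      unfolding form_integral_def eq Let_def prod.case
      by (rule suminf_finite[OF finite_lessThan], rule zero) simp
  qed
  show ?thesis 
    by (rule exI[of _ c], rule exI[of _ C], rule exI[of _ N], rule conjI, rule cC, intro allI impI, erule sum_eq)
qed

end

text \<open>Only the component at \<open>[1, 2, 3]\<close> enters the integral of a 3-form.\<close>

definition continuous_3form :: "'a::{t2_space,second_countable_topology} riemannian \<Rightarrow> 'a form \<Rightarrow> bool" where
  "continuous_3form M \<mu> \<longleftrightarrow>
     (\<forall>c\<in>charts M. continuous_on (range_of c) (component \<mu> c [1, 2, 3])) \<and>
     (\<exists>C. compact C \<and> C \<subseteq> points M \<and> supported_in C \<mu>)"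

section \<open>Linearity of the integral and passage to the limit\<close>

lemma supported_in_mono: "supported_in C \<omega> \<Longrightarrow> C \<subseteq> D \<Longrightarrow> supported_in D \<omega>"
  by (auto simp: supported_in_def)

lemma component_add: "component (\<omega> + \<eta>) c is = (\<lambda>x. component \<omega> c is x + component \<eta> c is x)"
  by (simp add: component_def plus_form_def fun_eq_iff)

lemma component_scaleR: "component (r *\<^sub>R \<omega>) c is = (\<lambda>x. r * component \<omega> c is x)"
  by (simp add: component_def scaleR_form_def fun_eq_iff)

lemma supported_in_add: "supported_in C \<omega> \<Longrightarrow> supported_in C \<eta> \<Longrightarrow> supported_in C (\<omega> + \<eta>)"
  by (auto simp: supported_in_def plus_form_def)

lemma supported_in_scaleR: "supported_in C \<omega> \<Longrightarrow> supported_in C (r *\<^sub>R \<omega>)"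
  by (auto simp: supported_in_def scaleR_form_def)

lemma set_integrable_lborel_compact:
  fixes f :: "'b::euclidean_space \<Rightarrow> real"
  assumes "compact K" "continuous_on K f" "S \<in> sets lborel" "S \<subseteq> K"
  shows "set_integrable lborel S f"
proof -
  have "set_integrable lborel K f"
    unfolding set_integrable_def using borel_integrable_compact[OF assms(1,2)]
    by (simp add: indicator_scaleR_eq_if)
  then show ?thesis using assms set_integrable_subset by blast
qed

text \<open>The set \<open>S\<close> has finite measure, so a uniform error \<epsilon> on
  \<open>K\<close> changes the integral by at most \<epsilon> times that measure.\<close>

lemma set_integral_uniform_limit:
  fixes f :: "nat \<Rightarrow> 'b::euclidean_space \<Rightarrow> real"
  assumes K: "compact K" and S: "S \<in> sets lborel" "S \<subseteq> K"
    and f: "\<And>n. continuous_on K (f n)" and F: "continuous_on K F"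
    and lim: "uniform_limit K f F sequentially"
  shows "(\<lambda>n. LINT x:S|lborel. f n x) \<longlonglongrightarrow> (LINT x:S|lborel. F x)"
proof (rule LIMSEQ_I)
  fix r :: real assume r: "r > 0"
  have int_f: "set_integrable lborel S (f n)" for n
    using set_integrable_lborel_compact[OF K f S] .
  have int_F: "set_integrable lborel S F" using set_integrable_lborel_compact[OF K F S] .
  define m where "m = measure lborel S"
  \<comment> \<open>The summand 1 avoids division by zero for a null set and makes the final bound
    strict.\<close>
  define \<epsilon> where "\<epsilon> = r / (m + 1)"
  have m: "m \<ge> 0" by (simp add: m_def)
  then have \<epsilon>: "\<epsilon> > 0" "\<epsilon> * m < r" using r by (auto simp: \<epsilon>_def field_simps)
  from uniform_limitD[OF lim \<epsilon>(1)] obtain N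
    where N: "\<And>n x. n \<ge> N \<Longrightarrow> x \<in> K \<Longrightarrow> dist (f n x) (F x) < \<epsilon>"
    unfolding eventually_sequentially by blast
  have int_\<epsilon>: "set_integrable lborel S (\<lambda>_. \<epsilon>)"
    using set_integrable_lborel_compact[OF K continuous_on_const S] .
  have "norm ((LINT x:S|lborel. f n x) - (LINT x:S|lborel. F x)) < r" if "n \<ge> N" for n
  proof -
    have "norm ((LINT x:S|lborel. f n x) - (LINT x:S|lborel. F x)) = norm (LINT x:S|lborel. f n x - F x)"
      using int_f int_F by (simp add: set_integral_diff)
    also have "\<dots> \<le> (LINT x:S|lborel. norm (f n x - F x))"
      using int_f int_F set_integral_norm_bound set_integral_diff(1) by blast
    also have "\<dots> \<le> (LINT x:S|lborel. \<epsilon>)"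
    proof (rule set_integral_mono)
      show "set_integrable lborel S (\<lambda>x. norm (f n x - F x))"
        using int_f int_F by (intro set_integrable_norm set_integral_diff)
      show "norm (f n x - F x) \<le> \<epsilon>" if "x \<in> S" for x
        using N[OF \<open>n \<ge> N\<close>, of x] that S by (auto simp: dist_norm)
    qed (rule int_\<epsilon>)
    also have "\<dots> = \<epsilon> * m"
      unfolding set_lebesgue_integral_def m_def by simp
    finally show ?thesis using \<epsilon> by simp
  qed
  then show "\<exists>N. \<forall>n\<ge>N. norm ((LINT x:S|lborel. f n x) - (LINT x:S|lborel. F x)) < r" by blast
qed

context riemannian3
begin

lemma chart_cover_piece:
  assumes "chart_cover M c C"
  shows "compact (coord (c n) ` C n)" "coord (c n) ` C n \<subseteq> range_of (c n)"
    "coord (c n) ` (C n - (\<Union>m<n. C m)) \<in> sets lborel"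
    "coord (c n) ` (C n - (\<Union>m<n. C m)) \<subseteq> coord (c n) ` C n"
proof -
  have *: "c n \<in> charts M" "compact (C n)" "C n \<subseteq> dom_of (c n)" for n
    using assms unfolding chart_cover_def by auto
  show "compact (coord (c n) ` C n)" by (rule compact_coord_image) (use * in auto)
  show "coord (c n) ` C n \<subseteq> range_of (c n)"
    unfolding range_of_def by (intro image_mono *)
  have inj: "inj_on (coord (c n)) (dom_of (c n))"
    using coord_inv_coord[OF *(1)] by (metis inj_onI)
  \<comment> \<open>Injectivity of the chart turns the image of a difference into a difference of
    compact images, which is Borel. The earlier sets are first cut down to \<open>C n\<close>, since
    they need not lie in the domain of \<open>c n\<close>.\<close>
  have "coord (c n) ` (C n - (\<Union>m<n. C m)) = coord (c n) ` C n - coord (c n) ` (C n \<inter> (\<Union>m<n. C m))"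
    using inj *(3)[of n] by (auto simp: inj_on_def subset_iff)
  moreover have "compact (C n \<inter> (\<Union>m<n. C m))"
    using * by (intro compact_Int compact_UN) auto
  then have "compact (coord (c n) ` (C n \<inter> (\<Union>m<n. C m)))"
    by (rule compact_coord_image[OF *(1)]) (use * in auto)
  ultimately show "coord (c n) ` (C n - (\<Union>m<n. C m)) \<in> sets lborel"
    using \<open>compact (coord (c n) ` C n)\<close> by (metis borel_compact sets.Diff sets_lborel)
  show "coord (c n) ` (C n - (\<Union>m<n. C m)) \<subseteq> coord (c n) ` C n" by auto
qed

lemma form_integral_scaleR:
  assumes "continuous_3form M \<mu>"
  shows "form_integral M (r *\<^sub>R \<mu>) = r * form_integral M \<mu>"
proof -
  obtain Q where Q: "compact Q" "Q \<subseteq> points M" "supported_in Q \<mu>"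
    using assms unfolding continuous_3form_def by blast
  obtain c C N where "chart_cover M c C" and
    eq: "\<forall>\<mu>. supported_in Q \<mu> \<longrightarrow> form_integral M \<mu> =
      (\<Sum>n<N. LINT x : coord (c n) ` (C n - (\<Union>m<n. C m)) | lborel. component \<mu> (c n) [1, 2, 3] x)"
    using form_integral_finite_sum[OF Q(1,2)] by (elim exE conjE) (rule that)
  show ?thesis
    unfolding eq[rule_format, OF Q(3)] eq[rule_format, OF supported_in_scaleR[OF Q(3)]] component_scaleR
      set_integral_mult_right sum_distrib_left ..
qed

text \<open>The union of the two supports is compact, so both forms and their sum are evaluated by
  one finite sum.\<close>

lemma form_integral_add:
  assumes \<mu>: "continuous_3form M \<mu>" and \<nu>: "continuous_3form M \<nu>"
  shows "form_integral M (\<mu> + \<nu>) = form_integral M \<mu> + form_integral M \<nu>"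
proof -
  obtain Q where Q: "compact Q" "Q \<subseteq> points M" "supported_in Q \<mu>"
    using \<mu> unfolding continuous_3form_def by blast
  obtain R where R: "compact R" "R \<subseteq> points M" "supported_in R \<nu>"
    using \<nu> unfolding continuous_3form_def by blast
  have *: "supported_in (Q \<union> R) \<mu>" "supported_in (Q \<union> R) \<nu>"
    using Q R supported_in_mono by blast+
  have QR: "compact (Q \<union> R)" "Q \<union> R \<subseteq> points M" using Q R by auto
  obtain c C N where cC: "chart_cover M c C"
    and eq: "\<forall>\<mu>. supported_in (Q \<union> R) \<mu> \<longrightarrow> form_integral M \<mu> =
      (\<Sum>n<N. LINT x : coord (c n) ` (C n - (\<Union>m<n. C m)) | lborel. component \<mu> (c n) [1, 2, 3] x)"
    using form_integral_finite_sum[OF QR] by (elim exE conjE) (rule that)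
  have int: "set_integrable lborel (coord (c n) ` (C n - (\<Union>m<n. C m))) (component \<rho> (c n) [1, 2, 3])"
    if "continuous_3form M \<rho>" for \<rho> n
    by (rule set_integrable_lborel_compact[OF chart_cover_piece(1)[OF cC] _ chart_cover_piece(3,4)[OF cC]],
        rule continuous_on_subset[OF _ chart_cover_piece(2)[OF cC]])
      (use that cC in \<open>auto simp: continuous_3form_def chart_cover_def\<close>)
  show ?thesis
    unfolding eq[rule_format, OF *(1)] eq[rule_format, OF *(2)] eq[rule_format, OF supported_in_add[OF *]] component_add
      set_integral_add(2)[OF int[OF \<mu>] int[OF \<nu>]] sum.distrib ..
qed

lemma form_integral_tendsto:
  assumes f: "\<And>n. continuous_3form M (f n)" and F: "continuous_3form M F"
    and Q: "compact Q" "Q \<subseteq> points M" "\<And>n. supported_in Q (f n)"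
    and lim: "\<And>c C. c \<in> charts M \<Longrightarrow> compact C \<Longrightarrow> C \<subseteq> dom_of c \<Longrightarrow>
      uniform_limit (coord c ` C) (\<lambda>n. component (f n) c [1, 2, 3]) (component F c [1, 2, 3]) sequentially"
  shows "(\<lambda>n. form_integral M (f n)) \<longlonglongrightarrow> form_integral M F"
proof -
  \<comment> \<open>The limit brings a compact support of its own; joining it to \<open>Q\<close>
    gives one finite sum for the sequence and its limit.\<close>
  obtain R where R: "compact R" "R \<subseteq> points M" "supported_in R F"
    using F unfolding continuous_3form_def by blast
  have *: "supported_in (Q \<union> R) (f n)" "supported_in (Q \<union> R) F" for n
    using Q R supported_in_mono by blast+
  have QR: "compact (Q \<union> R)" "Q \<union> R \<subseteq> points M" using Q R by auto
  obtain c C N where cC: "chart_cover M c C"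
    and eq: "\<forall>\<mu>. supported_in (Q \<union> R) \<mu> \<longrightarrow> form_integral M \<mu> =
      (\<Sum>n<N. LINT x : coord (c n) ` (C n - (\<Union>m<n. C m)) | lborel. component \<mu> (c n) [1, 2, 3] x)"
    using form_integral_finite_sum[OF QR] by (elim exE conjE) (rule that)
  have cont: "continuous_on (coord (c n) ` C n) (component \<rho> (c n) [1, 2, 3])"
    if "continuous_3form M \<rho>" for \<rho> n
    by (rule continuous_on_subset[OF _ chart_cover_piece(2)[OF cC]])
      (use that cC in \<open>auto simp: continuous_3form_def chart_cover_def\<close>)
  have conv: "(\<lambda>k. LINT x : coord (c n) ` (C n - (\<Union>m<n. C m)) | lborel. component (f k) (c n) [1, 2, 3] x)
      \<longlonglongrightarrow> (LINT x : coord (c n) ` (C n - (\<Union>m<n. C m)) | lborel. component F (c n) [1, 2, 3] x)" for n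
    using cC by (intro set_integral_uniform_limit[OF chart_cover_piece(1,3,4)[OF cC]] cont f F lim)
      (auto simp: chart_cover_def)
  show ?thesis unfolding eq[rule_format, OF *(1)] eq[rule_format, OF *(2)] by (rule tendsto_sum, rule conv)
qed

end

subsection \<open>Continuity of the inner product and of the Poincare pairing\<close>

lemma smooth_forms_continuous:
  assumes "\<omega> \<in> smooth_forms M s k" "c \<in> charts M" "length is = k"
  shows "continuous_on (range_of c) (component \<omega> c is)"
proof -
  have "smooth_on (range_of c) (component \<omega> c is)"
    using assms unfolding smooth_forms_def by blast
  then have "partials (range_of c) [] (component \<omega> c is) differentiable_on range_of c"
    unfolding smooth_on_def by blast
  then show ?thesis by (simp add: differentiable_imp_continuous_on)
qed

lemma smooth_forms_support:
  assumes "\<omega> \<in> smooth_forms M s k"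
  obtains C where "compact C" "C \<subseteq> points M" "supported_in C \<omega>"
  using assms unfolding smooth_forms_def by blast

lemma smooth_forms_outside:
  assumes "\<omega> \<in> smooth_forms M s k" "c \<notin> charts M \<or> p \<notin> dom_of c"
  shows "at_chart \<omega> c p vs = 0"
proof -
  have "\<forall>c p vs. c \<notin> charts M \<or> p \<notin> dom_of c \<longrightarrow> at_chart \<omega> c p vs = 0"
    using assms(1) unfolding smooth_forms_def by (elim CollectE conjE) assumption
  with assms(2) show ?thesis by blast
qed

lemma form_lim_component:
  assumes "form_lim M k f \<omega>" "c \<in> charts M" "compact C" "C \<subseteq> dom_of c" "length is = k"
  shows "uniform_limit (coord c ` C) (\<lambda>n. component (f n) c is) (component \<omega> c is) sequentially"
proof -
  have "uniform_limit (coord c ` C) (\<lambda>n. partials (range_of c) [] (component (f n) c is))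
      (partials (range_of c) [] (component \<omega> c is)) sequentially"
    using assms unfolding form_lim_def by blast
  then show ?thesis by simp
qed

lemma form_lim_support:
  assumes "form_lim M k f \<omega>"
  obtains C where "compact C" "C \<subseteq> points M" "\<forall>n. supported_in C (f n)"
  using assms unfolding form_lim_def by blast

lemma form_lim_const:
  assumes "\<omega> \<in> smooth_forms M s k"
  shows "form_lim M k (\<lambda>n. \<omega>) \<omega>"
proof -
  obtain C where "compact C" "C \<subseteq> points M" "supported_in C \<omega>"
    using assms by (rule smooth_forms_support)
  then show ?thesis unfolding form_lim_def by (intro conjI exI[of _ C] ballI allI impI uniform_limit_const)
qed

section \<open>Bilinear maps from pairs of forms to 3-forms\<close>

lemma uniform_limit_sum_real:
  fixes f :: "'j \<Rightarrow> nat \<Rightarrow> 'b \<Rightarrow> real"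
  assumes "\<And>j. j \<in> J \<Longrightarrow> uniform_limit S (f j) (g j) F"
  shows "uniform_limit S (\<lambda>n x. \<Sum>j\<in>J. f j n x) (\<lambda>x. \<Sum>j\<in>J. g j x) F"
  using assms
proof (induction J rule: infinite_finite_induct)
  case (insert j J)
  then show ?case by (auto intro!: uniform_limit_add)
qed (auto intro: uniform_limit_const)

text \<open>The common shape of \<open>inner_vol\<close> and \<open>wedge\<close>: in each chart the
  integrated component is a finite sum of continuous coefficients times one component of each
  factor. \<open>J\<close> consists of pairs of index tuples for the former and of permutations for
  the latter.\<close>

locale bilinear_3form = riemannian3 M
  for M :: "'a::{t2_space,second_countable_topology} riemannian" +
  fixes B :: "'a form \<Rightarrow> 'a form \<Rightarrow> 'a form"
    and k l :: nat
    and J :: "'j set"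
    and I L :: "'j \<Rightarrow> 3 list"
    and a :: "'a chart \<Rightarrow> 'j \<Rightarrow> real^3 \<Rightarrow> real"
  assumes length_I: "j \<in> J \<Longrightarrow> length (I j) = k"
    and length_L: "j \<in> J \<Longrightarrow> length (L j) = l"
    and continuous_a: "c \<in> charts M \<Longrightarrow> j \<in> J \<Longrightarrow> continuous_on (range_of c) (a c j)"
    and component_B: "component (B \<omega> \<eta>) c [1, 2, 3] x =
      (\<Sum>j\<in>J. a c j x * (component \<omega> c (I j) x * component \<eta> c (L j) x))"
    and supported_B: "supported_in C \<omega> \<Longrightarrow> supported_in C (B \<omega> \<eta>)"
    and B_add_left: "B (\<omega> + \<omega>') \<eta> = B \<omega> \<eta> + B \<omega>' \<eta>"
    and B_add_right: "B \<omega> (\<eta> + \<eta>') = B \<omega> \<eta> + B \<omega> \<eta>'"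
    and B_scaleR_left: "B (r *\<^sub>R \<omega>) \<eta> = r *\<^sub>R B \<omega> \<eta>"
    and B_scaleR_right: "B \<omega> (r *\<^sub>R \<eta>) = r *\<^sub>R B \<omega> \<eta>"
begin

lemma continuous_B:
  assumes "\<omega> \<in> smooth_forms M s k" "\<eta> \<in> smooth_forms M t l"
  shows "continuous_3form M (B \<omega> \<eta>)"
  unfolding continuous_3form_def
proof
  show "\<forall>c\<in>charts M. continuous_on (range_of c) (component (B \<omega> \<eta>) c [1, 2, 3])"
  proof
    fix c assume c: "c \<in> charts M"
    have "continuous_on (range_of c)
        (\<lambda>x. \<Sum>j\<in>J. a c j x * (component \<omega> c (I j) x * component \<eta> c (L j) x))"
      by (intro continuous_on_sum continuous_on_mult continuous_a c
          smooth_forms_continuous[OF assms(1) c length_I] smooth_forms_continuous[OF assms(2) c length_L])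
    then show "continuous_on (range_of c) (component (B \<omega> \<eta>) c [1, 2, 3])"
      by (simp only: component_B[abs_def])
  qed
  obtain C where "compact C" "C \<subseteq> points M" "supported_in C \<omega>"
    using assms(1) by (rule smooth_forms_support)
  then show "\<exists>C. compact C \<and> C \<subseteq> points M \<and> supported_in C (B \<omega> \<eta>)"
    by (intro exI[of _ C] conjI supported_B)
qed

lemma integral_B_add_left:
  assumes "\<omega> \<in> smooth_forms M s k" "\<omega>' \<in> smooth_forms M s k" "\<eta> \<in> smooth_forms M t l"
  shows "form_integral M (B (\<omega> + \<omega>') \<eta>) = form_integral M (B \<omega> \<eta>) + form_integral M (B \<omega>' \<eta>)"
  unfolding B_add_left by (intro form_integral_add continuous_B[OF assms(1,3)] continuous_B[OF assms(2,3)])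

lemma integral_B_add_right:
  assumes "\<omega> \<in> smooth_forms M s k" "\<eta> \<in> smooth_forms M t l" "\<eta>' \<in> smooth_forms M t l"
  shows "form_integral M (B \<omega> (\<eta> + \<eta>')) = form_integral M (B \<omega> \<eta>) + form_integral M (B \<omega> \<eta>')"
  unfolding B_add_right by (intro form_integral_add continuous_B[OF assms(1,2)] continuous_B[OF assms(1,3)])

lemma integral_B_scaleR_left:
  assumes "\<omega> \<in> smooth_forms M s k" "\<eta> \<in> smooth_forms M t l"
  shows "form_integral M (B (r *\<^sub>R \<omega>) \<eta>) = r * form_integral M (B \<omega> \<eta>)"
  unfolding B_scaleR_left by (intro form_integral_scaleR continuous_B[OF assms])

lemma integral_B_scaleR_right:
  assumes "\<omega> \<in> smooth_forms M s k" "\<eta> \<in> smooth_forms M t l"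
  shows "form_integral M (B \<omega> (r *\<^sub>R \<eta>)) = r * form_integral M (B \<omega> \<eta>)"
  unfolding B_scaleR_right by (intro form_integral_scaleR continuous_B[OF assms])

text \<open>A set that supports the first factor supports the product, which gives the
  \<open>B (f n) (g n)\<close> a common compact support. On compact subsets of a chart the
  coefficients and limit components are bounded, so products of uniform limits converge
  uniformly.\<close>

lemma integral_B_tendsto:
  assumes f: "\<And>n. f n \<in> smooth_forms M s k" and \<omega>: "\<omega> \<in> smooth_forms M s k"
    and g: "\<And>n. g n \<in> smooth_forms M t l" and \<eta>: "\<eta> \<in> smooth_forms M t l"
    and f_lim: "form_lim M k f \<omega>" and g_lim: "form_lim M l g \<eta>"
  shows "(\<lambda>n. form_integral M (B (f n) (g n))) \<longlonglongrightarrow> form_integral M (B \<omega> \<eta>)"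
proof -
  obtain Q where Q: "compact Q" "Q \<subseteq> points M" "\<forall>n. supported_in Q (f n)"
    using form_lim_support[OF f_lim] .
  show ?thesis
  proof (rule form_integral_tendsto[OF _ _ Q(1,2)])
    show "continuous_3form M (B (f n) (g n))" for n using f g by (rule continuous_B)
    show "continuous_3form M (B \<omega> \<eta>)" using \<omega> \<eta> by (rule continuous_B)
    show "supported_in Q (B (f n) (g n))" for n using Q(3) by (intro supported_B) (rule spec)
    fix c C assume c: "c \<in> charts M" and C: "compact C" "C \<subseteq> dom_of c"
    let ?K = "coord c ` C"
    have K: "compact ?K" using compact_coord_image[OF c C] .
    have sub: "?K \<subseteq> range_of c" unfolding range_of_def using C(2) by (rule image_mono)
    have bdd: "bounded (h ` ?K)" if "continuous_on (range_of c) h" for h :: "real^3 \<Rightarrow> real"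
      by (rule compact_imp_bounded, rule compact_continuous_image[OF continuous_on_subset[OF that sub] K])
    have "uniform_limit ?K
        (\<lambda>n x. \<Sum>j\<in>J. a c j x * (component (f n) c (I j) x * component (g n) c (L j) x))
        (\<lambda>x. \<Sum>j\<in>J. a c j x * (component \<omega> c (I j) x * component \<eta> c (L j) x)) sequentially"
    proof (rule uniform_limit_sum_real)
      fix j assume j: "j \<in> J"
      note cont_\<omega> = smooth_forms_continuous[OF \<omega> c length_I[OF j]]
      note cont_\<eta> = smooth_forms_continuous[OF \<eta> c length_L[OF j]]
      show "uniform_limit ?K
        (\<lambda>n x. a c j x * (component (f n) c (I j) x * component (g n) c (L j) x))
        (\<lambda>x. a c j x * (component \<omega> c (I j) x * component \<eta> c (L j) x)) sequentially"
        by (intro uniform_lim_mult uniform_limit_const bdd continuous_on_mult continuous_a c j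
            cont_\<omega> cont_\<eta> form_lim_component[OF f_lim c C length_I[OF j]]
            form_lim_component[OF g_lim c C length_L[OF j]])
    qed
    then show "uniform_limit ?K (\<lambda>n. component (B (f n) (g n)) c [1, 2, 3])
        (component (B \<omega> \<eta>) c [1, 2, 3]) sequentially"
      by (simp only: component_B[abs_def])
  qed
qed

end

section \<open>Inverse and determinant of the Gram matrix\<close>

lemma matrix_inv_inverse:
  fixes A :: "real^'n^'n"
  assumes "det A \<noteq> 0"
  shows "A ** matrix_inv A = mat 1" "matrix_inv A ** A = mat 1"
proof -
  have "\<exists>A'. A ** A' = mat 1 \<and> A' ** A = mat 1"
    using assms invertible_det_nz[of A] unfolding invertible_def by blast
  from someI_ex[OF this] show "A ** matrix_inv A = mat 1" "matrix_inv A ** A = mat 1"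
    unfolding matrix_inv_def by blast+
qed

text \<open>Column \<open>l\<close> of the inverse solves \<open>A *v x = axis l 1\<close>, to which
  Cramer's rule applies. The quotient of determinants makes continuity of the inverse
  visible.\<close>

lemma matrix_inv_cramer:
  fixes A :: "real^'n^'n"
  assumes "det A \<noteq> 0"
  shows "matrix_inv A $ k $ l = det (\<chi> i j. if j = k then axis l 1 $ i else A $ i $ j) / det A"
proof -
  have "A *v (matrix_inv A *v axis l 1) = axis l 1"
    by (simp add: matrix_vector_mul_assoc matrix_inv_inverse[OF assms])
  then have "matrix_inv A *v axis l 1 =
      (\<chi> k. det (\<chi> i j. if j = k then axis l 1 $ i else A $ i $ j) / det A)"
    using cramer[OF assms] by blast
  then have "(matrix_inv A *v axis l 1) $ k = det (\<chi> i j. if j = k then axis l 1 $ i else A $ i $ j) / det A"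
    by simp
  then show ?thesis by (simp add: matrix_vector_mult_basis column_def)
qed

text \<open>The transpose of the inverse is again a left inverse, because \<open>A\<close> is
  symmetric, and a left inverse equals the two-sided one.\<close>

lemma matrix_inv_symmetric:
  fixes A :: "real^'n^'n"
  assumes "det A \<noteq> 0" "transpose A = A"
  shows "matrix_inv A $ i $ j = matrix_inv A $ j $ i"
proof -
  let ?B = "matrix_inv A"
  have "transpose ?B ** A = mat 1"
    by (metis assms matrix_inv_inverse(1) matrix_transpose_mul transpose_mat)
  then have "transpose ?B = ?B"
    by (metis assms(1) matrix_inv_inverse(1) matrix_mul_assoc matrix_mul_lid matrix_mul_rid)
  then have "transpose ?B $ j $ i = ?B $ j $ i" by simp
  then show ?thesis by (simp add: transpose_def)
qed

lemma continuous_on_det: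
  fixes A :: "'b::topological_space \<Rightarrow> real^'n^'n"
  assumes "\<And>i j. continuous_on S (\<lambda>x. A x $ i $ j)"
  shows "continuous_on S (\<lambda>x. det (A x))"
  unfolding det_def
  by (intro continuous_on_sum continuous_on_mult continuous_on_const continuous_on_prod assms)

text \<open>Exchanging the two summation tuples swaps \<alpha> and \<beta> and transposes the
  inverse Gram matrix, which its symmetry undoes.\<close>

lemma covector_inner_symmetric:
  assumes "\<And>i j. matrix_inv G $ i $ j = matrix_inv G $ j $ i"
  shows "covector_inner k G \<alpha> \<beta> = covector_inner k G \<beta> \<alpha>"
proof -
  have "(\<Sum>is | length is = k. \<Sum>js | length js = k.
        (\<Prod>m<k. matrix_inv G $ (is ! m) $ (js ! m)) *
        \<alpha> (map (\<lambda>i. axis i 1) is) * \<beta> (map (\<lambda>j. axis j 1) js)) =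
    (\<Sum>js | length js = k. \<Sum>is | length is = k.
        (\<Prod>m<k. matrix_inv G $ (js ! m) $ (is ! m)) *
        \<beta> (map (\<lambda>i. axis i 1) js) * \<alpha> (map (\<lambda>j. axis j 1) is))"
    by (subst sum.swap, intro sum.cong refl, subst assms) (simp only: mult.commute mult.left_commute mult.assoc)
  then show ?thesis unfolding covector_inner_def by simp
qed

section \<open>The metric and the two concrete bilinear maps\<close>

context riemannian3
begin

lemma metric_symmetric: "c \<in> charts M \<Longrightarrow> p \<in> dom_of c \<Longrightarrow> transpose (metric M c p) = metric M c p"
  using riemannian unfolding riemannian_manifold3_def by blast

text \<open>A nonzero kernel vector would contradict positive definiteness, and a trivial kernel
  gives a left inverse.\<close>

lemma det_metric_nonzero:
  assumes "c \<in> charts M" "p \<in> dom_of c"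
  shows "det (metric M c p) \<noteq> 0"
proof -
  let ?G = "metric M c p"
  have pos: "v \<noteq> 0 \<Longrightarrow> v \<bullet> (?G *v v) > 0" for v
    using riemannian assms unfolding riemannian_manifold3_def by blast
  have "v = 0" if "?G *v v = 0" for v
    using pos[of v] that by (cases "v = 0") simp_all
  then have "\<exists>B. B ** ?G = mat 1" by (simp only: matrix_left_invertible_ker) blast
  then show ?thesis using invertible_left_inverse invertible_det_nz by blast
qed

lemma continuous_metric:
  assumes "c \<in> charts M"
  shows "continuous_on (range_of c) (\<lambda>x. metric M c (coord_inv c x) $ i $ j)"
proof -
  have "smooth_on (range_of c) (\<lambda>x. metric M c (coord_inv c x) $ i $ j)"
    using riemannian assms unfolding riemannian_manifold3_def by blast
  then have "partials (range_of c) [] (\<lambda>x. metric M c (coord_inv c x) $ i $ j) differentiable_on range_of c"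
    unfolding smooth_on_def by blast
  then show ?thesis by (simp add: differentiable_imp_continuous_on)
qed

lemma continuous_metric_inv:
  assumes c: "c \<in> charts M"
  shows "continuous_on (range_of c) (\<lambda>x. matrix_inv (metric M c (coord_inv c x)) $ i $ j)"
proof -
  let ?G = "\<lambda>x. metric M c (coord_inv c x)"
  have nz: "det (?G x) \<noteq> 0" if "x \<in> range_of c" for x
    using det_metric_nonzero[OF c coord_inv_in_dom[OF c that]] .
  have "continuous_on (range_of c) (\<lambda>x. (if b then C else ?G x $ i' $ j'))" for b C i' j'
    using continuous_metric[OF c] by (cases b) simp_all
  then have "continuous_on (range_of c)
      (\<lambda>x. det (\<chi> i' j'. if j' = i then axis j 1 $ i' else ?G x $ i' $ j') / det (?G x))"
    using nz by (intro continuous_on_divide continuous_on_det) (simp_all add: continuous_metric[OF c])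
  then show ?thesis
    by (rule continuous_on_eq) (simp add: matrix_inv_cramer nz)
qed

text \<open>The determinant of the three basis vectors, from evaluating the volume form on them,
  stays in the coefficient as a constant.\<close>

lemma bilinear_inner_vol:
  "bilinear_3form M (inner_vol M k) k k ({is. length is = k} \<times> {is. length is = k}) fst snd
    (\<lambda>c (is, js) x. (\<Prod>m<k. matrix_inv (metric M c (coord_inv c x)) $ (is ! m) $ (js ! m)) / fact k *
      (sqrt (det (metric M c (coord_inv c x))) * det (vector [axis 1 1, axis 2 1, axis 3 1] :: real^3^3)))"
proof
  show "continuous_on (range_of c)
      ((\<lambda>(is, js) x. (\<Prod>m<k. matrix_inv (metric M c (coord_inv c x)) $ (is ! m) $ (js ! m)) / fact k *
        (sqrt (det (metric M c (coord_inv c x))) * det (vector [axis 1 1, axis 2 1, axis 3 1] :: real^3^3))) j)"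
    if c: "c \<in> charts M" for c j
    unfolding case_prod_beta
    by (intro continuous_on_mult continuous_on_divide continuous_on_prod continuous_on_const
        continuous_on_real_sqrt continuous_on_det continuous_metric[OF c] continuous_metric_inv[OF c]) simp
  show "component (inner_vol M k \<omega> \<eta>) c [1, 2, 3] x =
    (\<Sum>j\<in>{is. length is = k} \<times> {is. length is = k}.
      (case j of (is, js) \<Rightarrow> \<lambda>x. (\<Prod>m<k. matrix_inv (metric M c (coord_inv c x)) $ (is ! m) $ (js ! m)) / fact k *
        (sqrt (det (metric M c (coord_inv c x))) * det (vector [axis 1 1, axis 2 1, axis 3 1] :: real^3^3))) x *
      (component \<omega> c (fst j) x * component \<eta> c (snd j) x))" for \<omega> \<eta> c x
    unfolding component_def inner_vol_def at_chart_Form covector_inner_def sum.cartesian_product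
    by (simp add: case_prod_beta sum_divide_distrib sum_distrib_right mult.assoc)
      (intro sum.cong refl, simp)
qed (auto simp: supported_in_def inner_vol_def covector_inner_def plus_form_def scaleR_form_def
    form_eqI algebra_simps sum.distrib sum_distrib_left add_divide_distrib)

text \<open>On basis vectors each permutation hands the first \<open>k\<close> permuted vectors to
  one factor and the remaining \<open>3 - k\<close> to the other, so components with permuted
  indices appear with the normalised sign as constant coefficient.\<close>

lemma bilinear_wedge:
  assumes k: "k \<le> 3"
  shows "bilinear_3form M (wedge k (3 - k)) k (3 - k) {\<sigma>. \<sigma> permutes {..<3}}
    (\<lambda>\<sigma>. map (\<lambda>i. [1, 2, 3] ! \<sigma> i) [0..<k]) (\<lambda>\<sigma>. map (\<lambda>i. [1, 2, 3] ! \<sigma> i) [k..<3])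
    (\<lambda>c \<sigma> x. of_int (sign \<sigma>) / (fact k * fact (3 - k)))"
proof
  have k3: "k + (3 - k) = 3" using k by simp
  show "component (wedge k (3 - k) \<omega> \<eta>) c [1, 2, 3] x =
    (\<Sum>\<sigma> | \<sigma> permutes {..<3}. of_int (sign \<sigma>) / (fact k * fact (3 - k)) *
      (component \<omega> c (map (\<lambda>i. [1, 2, 3] ! \<sigma> i) [0..<k]) x *
       component \<eta> c (map (\<lambda>i. [1, 2, 3] ! \<sigma> i) [k..<3]) x))" for \<omega> \<eta> c x
  proof -
    let ?vs = "map (\<lambda>i. axis i 1) [1, 2, 3] :: (real^3) list"
    \<comment> \<open>A permutation of \<open>{..<3}\<close> never leaves the list, so selecting
      positions commutes with forming basis vectors.\<close>
    have basis: "map (\<lambda>i. ?vs ! \<sigma> i) [m..<n] = map (\<lambda>i. axis i 1) (map (\<lambda>i. [1, 2, 3] ! \<sigma> i) [m..<n])"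
      if \<sigma>: "\<sigma> permutes {..<3}" and n: "n \<le> 3" for \<sigma> m n
    proof -
      have "?vs ! \<sigma> i = axis ([1, 2, 3] ! \<sigma> i) 1" if "i \<in> set [m..<n]" for i
      proof -
        have "i \<in> {..<3}" using that n by auto
        then have "\<sigma> i < 3" using permutes_in_image[OF \<sigma>] by blast
        then show ?thesis by (intro nth_map) simp
      qed
      then show ?thesis by (simp only: map_map o_def cong: map_cong)
    qed
    have "component (wedge k (3 - k) \<omega> \<eta>) c [1, 2, 3] x =
      (\<Sum>\<sigma> | \<sigma> permutes {..<3}. of_int (sign \<sigma>) *
          at_chart \<omega> c (coord_inv c x) (map (\<lambda>i. ?vs ! \<sigma> i) [0..<k]) *
          at_chart \<eta> c (coord_inv c x) (map (\<lambda>i. ?vs ! \<sigma> i) [k..<3])) / (fact k * fact (3 - k))"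
      unfolding component_def wedge_def at_chart_Form k3 by simp
    also have "\<dots> = (\<Sum>\<sigma> | \<sigma> permutes {..<3}. of_int (sign \<sigma>) *
          component \<omega> c (map (\<lambda>i. [1, 2, 3] ! \<sigma> i) [0..<k]) x *
          component \<eta> c (map (\<lambda>i. [1, 2, 3] ! \<sigma> i) [k..<3]) x) / (fact k * fact (3 - k))"
      unfolding component_def using k by (intro arg_cong2[where f="(/)"] sum.cong refl) (simp only: basis mem_Collect_eq order_refl)
    finally show ?thesis by (simp add: sum_divide_distrib mult.assoc)
  qed
qed (auto simp: supported_in_def wedge_def plus_form_def scaleR_form_def continuous_on_const
    form_eqI algebra_simps sum.distrib sum_distrib_left add_divide_distrib)

section \<open>Bilinearity and joint limits of the pairing and the inner product\<close>

lemma poincare_pairing_add_right: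
  assumes "k \<le> 3" "\<omega> \<in> smooth_forms M s k" "\<eta> \<in> smooth_forms M t (3 - k)" "\<eta>' \<in> smooth_forms M t (3 - k)"
  shows "poincare_pairing M k \<omega> (\<eta> + \<eta>') = poincare_pairing M k \<omega> \<eta> + poincare_pairing M k \<omega> \<eta>'"
  unfolding poincare_pairing_def
  by (rule bilinear_3form.integral_B_add_right[OF bilinear_wedge]) (rule assms)+

lemma poincare_pairing_scaleR_right:
  assumes "k \<le> 3" "\<omega> \<in> smooth_forms M s k" "\<eta> \<in> smooth_forms M t (3 - k)"
  shows "poincare_pairing M k \<omega> (r *\<^sub>R \<eta>) = r * poincare_pairing M k \<omega> \<eta>"
  unfolding poincare_pairing_def
  by (rule bilinear_3form.integral_B_scaleR_right[OF bilinear_wedge]) (rule assms)+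

lemma poincare_pairing_add_left:
  assumes "k \<le> 3" "\<omega> \<in> smooth_forms M s k" "\<omega>' \<in> smooth_forms M s k" "\<eta> \<in> smooth_forms M t (3 - k)"
  shows "poincare_pairing M k (\<omega> + \<omega>') \<eta> = poincare_pairing M k \<omega> \<eta> + poincare_pairing M k \<omega>' \<eta>"
  unfolding poincare_pairing_def
  by (rule bilinear_3form.integral_B_add_left[OF bilinear_wedge]) (rule assms)+

lemma poincare_pairing_scaleR_left:
  assumes "k \<le> 3" "\<omega> \<in> smooth_forms M s k" "\<eta> \<in> smooth_forms M t (3 - k)"
  shows "poincare_pairing M k (r *\<^sub>R \<omega>) \<eta> = r * poincare_pairing M k \<omega> \<eta>"
  unfolding poincare_pairing_def
  by (rule bilinear_3form.integral_B_scaleR_left[OF bilinear_wedge]) (rule assms)+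

lemma poincare_pairing_tendsto:
  assumes "k \<le> 3"
    and "\<And>n. f n \<in> smooth_forms M s k" "\<omega> \<in> smooth_forms M s k"
    and "\<And>n. g n \<in> smooth_forms M t (3 - k)" "\<eta> \<in> smooth_forms M t (3 - k)"
    and "form_lim M k f \<omega>" "form_lim M (3 - k) g \<eta>"
  shows "(\<lambda>n. poincare_pairing M k (f n) (g n)) \<longlonglongrightarrow> poincare_pairing M k \<omega> \<eta>"
  unfolding poincare_pairing_def
  by (rule bilinear_3form.integral_B_tendsto[OF bilinear_wedge]) (rule assms)+

lemma L2_inner_add_left:
  assumes "\<omega> \<in> smooth_forms M s k" "\<omega>' \<in> smooth_forms M s k" "\<eta> \<in> smooth_forms M t k"
  shows "L2_inner M k (\<omega> + \<omega>') \<eta> = L2_inner M k \<omega> \<eta> + L2_inner M k \<omega>' \<eta>"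
  unfolding L2_inner_def
  by (rule bilinear_3form.integral_B_add_left[OF bilinear_inner_vol]) (rule assms)+

lemma L2_inner_add_right:
  assumes "\<omega> \<in> smooth_forms M s k" "\<eta> \<in> smooth_forms M t k" "\<eta>' \<in> smooth_forms M t k"
  shows "L2_inner M k \<omega> (\<eta> + \<eta>') = L2_inner M k \<omega> \<eta> + L2_inner M k \<omega> \<eta>'"
  unfolding L2_inner_def
  by (rule bilinear_3form.integral_B_add_right[OF bilinear_inner_vol]) (rule assms)+

lemma L2_inner_scaleR_left:
  assumes "\<omega> \<in> smooth_forms M s k" "\<eta> \<in> smooth_forms M t k"
  shows "L2_inner M k (r *\<^sub>R \<omega>) \<eta> = r * L2_inner M k \<omega> \<eta>"
  unfolding L2_inner_def
  by (rule bilinear_3form.integral_B_scaleR_left[OF bilinear_inner_vol]) (rule assms)+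

lemma L2_inner_scaleR_right:
  assumes "\<omega> \<in> smooth_forms M s k" "\<eta> \<in> smooth_forms M t k"
  shows "L2_inner M k \<omega> (r *\<^sub>R \<eta>) = r * L2_inner M k \<omega> \<eta>"
  unfolding L2_inner_def
  by (rule bilinear_3form.integral_B_scaleR_right[OF bilinear_inner_vol]) (rule assms)+

lemma L2_inner_tendsto:
  assumes "\<And>n. f n \<in> smooth_forms M s k" "\<omega> \<in> smooth_forms M s k"
    and "\<And>n. g n \<in> smooth_forms M t k" "\<eta> \<in> smooth_forms M t k"
    and "form_lim M k f \<omega>" "form_lim M k g \<eta>"
  shows "(\<lambda>n. L2_inner M k (f n) (g n)) \<longlonglongrightarrow> L2_inner M k \<omega> \<eta>"
  unfolding L2_inner_def
  by (rule bilinear_3form.integral_B_tendsto[OF bilinear_inner_vol]) (rule assms)+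

lemma L2_inner_commute:
  assumes \<omega>: "\<omega> \<in> smooth_forms M s k" and \<eta>: "\<eta> \<in> smooth_forms M t k"
  shows "L2_inner M k \<omega> \<eta> = L2_inner M k \<eta> \<omega>"
proof -
  have "covector_inner k (metric M c p) (at_chart \<omega> c p) (at_chart \<eta> c p) =
      covector_inner k (metric M c p) (at_chart \<eta> c p) (at_chart \<omega> c p)" for c p
  proof (cases "c \<in> charts M \<and> p \<in> dom_of c")
    case True
    then show ?thesis
      by (intro covector_inner_symmetric matrix_inv_symmetric det_metric_nonzero metric_symmetric) auto
  next
    \<comment> \<open>Nothing is known about \<open>metric\<close> off the chart, but both forms
      vanish there, so the two 3-forms agree as functions.\<close>
    case False
    then have "c \<notin> charts M \<or> p \<notin> dom_of c" by blast
    note smooth_forms_outside[OF \<omega> this] smooth_forms_outside[OF \<eta> this]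
    then show ?thesis by (simp add: covector_inner_def)
  qed
  then have "inner_vol M k \<omega> \<eta> = inner_vol M k \<eta> \<omega>" unfolding inner_vol_def by presburger
  then show ?thesis by (simp add: L2_inner_def)
qed

end

subsection \<open>Hadamard derivatives\<close>

lemma has_derivD:
  assumes "has_deriv X Y F D x"
  shows has_deriv_closed: "u \<in> fst X \<Longrightarrow> D u \<in> fst Y"
    and has_deriv_add: "u \<in> fst X \<Longrightarrow> v \<in> fst X \<Longrightarrow> D (u + v) = D u + D v"
    and has_deriv_scaleR: "u \<in> fst X \<Longrightarrow> D (r *\<^sub>R u) = r *\<^sub>R D u"
    and has_deriv_lim: "(\<And>n. t n \<noteq> 0) \<Longrightarrow> t \<longlonglongrightarrow> 0 \<Longrightarrow> (\<And>n. w n \<in> fst X) \<Longrightarrow> u \<in> fst X \<Longrightarrow>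
      snd X w u \<Longrightarrow> snd Y (\<lambda>n. (F (x + t n *\<^sub>R w n) - F x) /\<^sub>R t n) (D u)"
  using assms unfolding has_deriv_def by simp_all

lemma has_deriv_cong:
  assumes "has_deriv X Y F D x" "\<And>u. u \<in> fst X \<Longrightarrow> D u = D' u" "subspace (fst X)"
  shows "has_deriv X Y F D' x"
  unfolding has_deriv_def
proof (intro conjI ballI allI impI; (elim conjE)?)
  note D = assms(1) and eq = assms(2)[symmetric]
  fix u v r assume u: "u \<in> fst X"
  show "D' u \<in> fst Y" unfolding eq[OF u] using has_deriv_closed[OF D u] .
  show "D' (r *\<^sub>R u) = r *\<^sub>R D' u"
    unfolding eq[OF u] eq[OF subspace_scale[OF assms(3) u]] using has_deriv_scaleR[OF D u] .
  assume v: "v \<in> fst X"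
  show "D' (u + v) = D' u + D' v"
    unfolding eq[OF u] eq[OF v] eq[OF subspace_add[OF assms(3) u v]] using has_deriv_add[OF D u v] .
next
  fix t :: "nat \<Rightarrow> real" and v w
  assume *: "\<forall>n. t n \<noteq> 0" "t \<longlonglongrightarrow> 0" "\<forall>n. v n \<in> fst X" "snd X v w" and w: "w \<in> fst X"
  show "snd Y (\<lambda>n. (F (x + t n *\<^sub>R v n) - F x) /\<^sub>R t n) (D' w)"
    unfolding assms(2)[OF w, symmetric] using * w by (intro has_deriv_lim[OF assms(1)]) simp_all
qed

text \<open>Along \<open>t n = 1 / (n + 1)\<close> with constant direction \<open>u\<close>, the
  same difference quotients converge to both values. Convergence of the constant sequence is a
  premise because a \<open>lim_space\<close> carries an arbitrary notion of convergence.\<close>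

lemma has_deriv_unique:
  assumes D: "has_deriv X real_space F D x" and D': "has_deriv X real_space F D' x"
    and u: "u \<in> fst X" "snd X (\<lambda>n. u) u"
  shows "D u = D' u"
proof -
  have t: "inverse (real (Suc n)) \<noteq> 0" for n by simp
  note lim = has_deriv_lim[OF _ t LIMSEQ_inverse_real_of_nat u(1) u]
  from lim[OF D] lim[OF D'] show ?thesis
    unfolding real_space_def by (auto intro: LIMSEQ_unique)
qed

lemma has_deriv_partial_fst:
  assumes D: "has_deriv (prod_space X Y) Z (\<lambda>(x, y). F x y) D (x, y)"
    and zero: "0 \<in> fst Y" "snd Y (\<lambda>n. 0) 0"
  shows "has_deriv X Z (\<lambda>x'. F x' y) (\<lambda>u. D (u, 0)) x"
  unfolding has_deriv_def
proof (intro conjI ballI allI impI; (elim conjE)?)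
  fix u v r assume u: "u \<in> fst X"
  then have u': "(u, 0) \<in> fst (prod_space X Y)" using zero by (simp add: prod_space_def)
  show "D (u, 0) \<in> fst Z" using has_deriv_closed[OF D u'] .
  show "D (r *\<^sub>R u, 0) = r *\<^sub>R D (u, 0)" using has_deriv_scaleR[OF D u', of r] by simp
  assume "v \<in> fst X"
  then have "(v, 0) \<in> fst (prod_space X Y)" using zero by (simp add: prod_space_def)
  from has_deriv_add[OF D u' this] show "D (u + v, 0) = D (u, 0) + D (v, 0)" by simp
next
  fix t :: "nat \<Rightarrow> real" and v w assume "\<forall>n. t n \<noteq> 0" "t \<longlonglongrightarrow> 0" "\<forall>n. v n \<in> fst X" "w \<in> fst X" "snd X v w"
  then show "snd Z (\<lambda>n. (F (x + t n *\<^sub>R v n) y - F x y) /\<^sub>R t n) (D (w, 0))"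
    using has_deriv_lim[OF D, of t "\<lambda>n. (v n, 0)" "(w, 0)"] zero by (simp add: prod_space_def)
qed

lemma has_deriv_partial_snd:
  assumes D: "has_deriv (prod_space X Y) Z (\<lambda>(x, y). F x y) D (x, y)"
    and zero: "0 \<in> fst X" "snd X (\<lambda>n. 0) 0"
  shows "has_deriv Y Z (\<lambda>y'. F x y') (\<lambda>v. D (0, v)) y"
  unfolding has_deriv_def
proof (intro conjI ballI allI impI; (elim conjE)?)
  fix u v r assume u: "u \<in> fst Y"
  then have u': "(0, u) \<in> fst (prod_space X Y)" using zero by (simp add: prod_space_def)
  show "D (0, u) \<in> fst Z" using has_deriv_closed[OF D u'] .
  show "D (0, r *\<^sub>R u) = r *\<^sub>R D (0, u)" using has_deriv_scaleR[OF D u', of r] by simp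
  assume "v \<in> fst Y"
  then have "(0, v) \<in> fst (prod_space X Y)" using zero by (simp add: prod_space_def)
  from has_deriv_add[OF D u' this] show "D (0, u + v) = D (0, u) + D (0, v)" by simp
next
  fix t :: "nat \<Rightarrow> real" and v w assume "\<forall>n. t n \<noteq> 0" "t \<longlonglongrightarrow> 0" "\<forall>n. v n \<in> fst Y" "w \<in> fst Y" "snd Y v w"
  then show "snd Z (\<lambda>n. (F x (y + t n *\<^sub>R v n) - F x y) /\<^sub>R t n) (D (0, w))"
    using has_deriv_lim[OF D, of t "\<lambda>n. (0, v n)" "(0, w)"] zero by (simp add: prod_space_def)
qed

text \<open>Additivity splits \<open>(u, v)\<close> into \<open>(u, 0) + (0, v)\<close>, and
  uniqueness identifies the two restrictions with the given partial derivatives.\<close>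

lemma has_deriv_total:
  assumes D: "has_deriv (prod_space X Y) real_space (\<lambda>(x, y). F x y) D (x, y)"
    and D1: "has_deriv X real_space (\<lambda>x'. F x' y) D1 x"
    and D2: "has_deriv Y real_space (\<lambda>y'. F x y') D2 y"
    and zero: "0 \<in> fst X" "0 \<in> fst Y"
    and const: "\<And>u. u \<in> fst X \<Longrightarrow> snd X (\<lambda>n. u) u" "\<And>v. v \<in> fst Y \<Longrightarrow> snd Y (\<lambda>n. v) v"
    and u: "u \<in> fst X" and v: "v \<in> fst Y"
  shows "D (u, v) = D1 u + D2 v"
proof -
  have "D (u, v) = D ((u, 0) + (0, v))" by simp
  also have "\<dots> = D (u, 0) + D (0, v)"
    by (rule has_deriv_add[OF D]) (use zero u v in \<open>simp_all add: prod_space_def\<close>)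
  also have "D (u, 0) = D1 u"
    using has_deriv_unique[OF has_deriv_partial_fst[OF D] D1] zero const u by blast
  also have "D (0, v) = D2 v"
    using has_deriv_unique[OF has_deriv_partial_snd[OF D] D2] zero const v by blast
  finally show ?thesis .
qed

subsection \<open>The Legendre transform\<close>

theorem proposition9:
  fixes M :: "'a::{t2_space,second_countable_topology} riemannian"
    and V W :: "nat \<Rightarrow> 'a form set"
    and star :: "nat \<Rightarrow> 'a form \<Rightarrow> 'a form"
    and K H Hbar :: "'a form \<Rightarrow> 'a form \<Rightarrow> real"
    and Ke Kb tKe tKb d h :: "'a form \<Rightarrow> 'a form \<Rightarrow> 'a form"
  assumes M: "riemannian_manifold3 M"
    and V: "\<And>k. k \<le> 3 \<Longrightarrow> boundary_condition M Straight k (V k)"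
    and W: "\<And>k. k \<le> 3 \<Longrightarrow> boundary_condition M Twisted k (W k)"
    and star: "is_hodge_star M V W star"
    and K_diff: "differentiable_map (prod_space (form_space M 1 (V 1)) (form_space M 2 (V 2)))
                   real_space (\<lambda>(e, b). K e b)"
    and Ke: "\<And>e b. e \<in> V 1 \<Longrightarrow> b \<in> V 2 \<Longrightarrow> has_fun_deriv M V 1 (\<lambda>e'. K e' b) (Ke e b) e"
    and Kb: "\<And>e b. e \<in> V 1 \<Longrightarrow> b \<in> V 2 \<Longrightarrow> has_fun_deriv M V 2 (\<lambda>b'. K e b') (Kb e b) b"
    and tKe: "\<And>e b. e \<in> V 1 \<Longrightarrow> b \<in> V 2 \<Longrightarrow>
                has_tw_fun_deriv_straight M V W 1 (\<lambda>e'. K e' b) (tKe e b) e"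
    and tKb: "\<And>e b. e \<in> V 1 \<Longrightarrow> b \<in> V 2 \<Longrightarrow>
                has_tw_fun_deriv_straight M V W 2 (\<lambda>b'. K e b') (tKb e b) b"
    and Ke_diff: "differentiable_map (prod_space (form_space M 1 (V 1)) (form_space M 2 (V 2)))
                    (form_space M 1 (V 1)) (\<lambda>(e, b). Ke e b)"
    and Kb_diff: "differentiable_map (prod_space (form_space M 1 (V 1)) (form_space M 2 (V 2)))
                    (form_space M 2 (V 2)) (\<lambda>(e, b). Kb e b)"
    and H: "\<And>e b. e \<in> V 1 \<Longrightarrow> b \<in> V 2 \<Longrightarrow>
              H e b = K e b - L2_inner M 1 e (Ke e b)
                      + 1 / (8 * pi) * (L2_inner M 1 e e + L2_inner M 2 b b)"
    and d: "\<And>e b. e \<in> V 1 \<Longrightarrow> b \<in> V 2 \<Longrightarrow> d e b = star 1 e - (4 * pi) *\<^sub>R tKe e b"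
    and h: "\<And>e b. e \<in> V 1 \<Longrightarrow> b \<in> V 2 \<Longrightarrow> h e b = star 2 b + (4 * pi) *\<^sub>R tKb e b"
    and diffeo: "diffeomorphism (prod_space (form_space M 1 (V 1)) (form_space M 2 (V 2)))
                   (prod_space (form_space M 2 (W 2)) (form_space M 2 (V 2)))
                   (\<lambda>(e, b). (d e b, b))"
    and Hbar: "\<And>e b. e \<in> V 1 \<Longrightarrow> b \<in> V 2 \<Longrightarrow> Hbar (d e b) b = H e b"
    and e: "e \<in> V 1" and b: "b \<in> V 2"
  shows "has_tw_fun_deriv_twisted M V W 2 (\<lambda>d'. Hbar d' b) (e /\<^sub>R (4 * pi)) (d e b) \<and>
         has_tw_fun_deriv_straight M V W 2 (\<lambda>b'. Hbar (d e b) b')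
           (star 2 b /\<^sub>R (4 * pi) + tKb e b) b \<and>
         star 2 b /\<^sub>R (4 * pi) + tKb e b = h e b /\<^sub>R (4 * pi)"
proof -

  \<comment> \<open>The spaces of forms and their convergence\<close>
  interpret riemannian3 M by unfold_locales (rule M)
  have three: "3 - 2 = (1::nat)" by simp
  \<comment> \<open>Keeps the degree 1 from being rewritten to \<open>Suc 0\<close>, so that facts
    about \<open>form_space M 1\<close> still match.\<close>
  note One_nat_def [simp del]
  let ?X = "form_space M 1 (V 1)" and ?Y = "form_space M 2 (V 2)" and ?Z = "form_space M 2 (W 2)"
  let ?L = "L2_inner M" and ?P = "poincare_pairing M"
  have V_smooth: "\<omega> \<in> smooth_forms M Straight k" if "\<omega> \<in> V k" "k \<le> 3" for \<omega> k
    using V[OF that(2)] that(1) unfolding boundary_condition_def by blast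
  have W_smooth: "\<omega> \<in> smooth_forms M Twisted k" if "\<omega> \<in> W k" "k \<le> 3" for \<omega> k
    using W[OF that(2)] that(1) unfolding boundary_condition_def by blast
  have V_subspace: "subspace (V k)" if "k \<le> 3" for k
    using V[OF that] unfolding boundary_condition_def by blast
  have W_subspace: "subspace (W k)" if "k \<le> 3" for k
    using W[OF that] unfolding boundary_condition_def by blast
  have V1: "\<omega> \<in> V 1 \<Longrightarrow> \<omega> \<in> smooth_forms M Straight 1" for \<omega> by (rule V_smooth) simp_all
  have V2: "\<omega> \<in> V 2 \<Longrightarrow> \<omega> \<in> smooth_forms M Straight 2" for \<omega> by (rule V_smooth) simp_all
  \<comment> \<open>The degrees are written \<open>3 - 1\<close> and \<open>3 - 2\<close> to fit the
    pairing rules, which speak of \<open>3 - k\<close>.\<close>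
  have W2: "\<omega> \<in> W 2 \<Longrightarrow> \<omega> \<in> smooth_forms M Twisted (3 - 1)" for \<omega> using W_smooth[of \<omega> 2] by simp
  have W1: "\<omega> \<in> W 1 \<Longrightarrow> \<omega> \<in> smooth_forms M Twisted (3 - 2)" for \<omega>
    unfolding three by (rule W_smooth) simp_all
  have sub: "subspace (V 1)" "subspace (V 2)" "subspace (W 1)" "subspace (W 2)"
    by (simp_all add: V_subspace W_subspace)
  have spaces [simp]: "fst ?X = V 1" "fst ?Y = V 2" "fst ?Z = W 2"
    "snd ?X = form_lim M 1" "snd ?Y = form_lim M 2" "snd ?Z = form_lim M 2"
    by (simp_all add: form_space_def)
  have prod_spaces: "(u, v) \<in> fst (prod_space A B) \<longleftrightarrow> u \<in> fst A \<and> v \<in> fst B"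
    "snd (prod_space A B) f z \<longleftrightarrow> snd A (\<lambda>n. fst (f n)) (fst z) \<and> snd B (\<lambda>n. snd (f n)) (snd z)"
    for A :: "'x lim_space" and B :: "'y lim_space" and u v f z
    by (simp_all add: prod_space_def)
  have const1: "form_lim M 1 (\<lambda>n. \<omega>) \<omega>" if "\<omega> \<in> V 1" for \<omega> using form_lim_const[OF V1[OF that]] .
  have const2: "form_lim M 2 (\<lambda>n. \<omega>) \<omega>" if "\<omega> \<in> V 2" for \<omega> using form_lim_const[OF V2[OF that]] .
  have const2': "form_lim M 2 (\<lambda>n. \<omega>) \<omega>" if "\<omega> \<in> W 2" for \<omega>
    using form_lim_const[OF W_smooth[OF that]] by simp

  \<comment> \<open>Hodge star and first derivatives of \<open>K\<close>\<close>
  have star1: "star 1 \<eta> \<in> W 2" "\<omega> \<in> V 1 \<Longrightarrow> ?L 1 \<omega> \<eta> = ?P 1 \<omega> (star 1 \<eta>)" if "\<eta> \<in> V 1" for \<eta> \<omega>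
    using star[unfolded is_hodge_star_def, rule_format, of 1 \<eta>] that by simp_all
  have star2: "star 2 \<eta> \<in> W 1" "\<omega> \<in> V 2 \<Longrightarrow> ?L 2 \<omega> \<eta> = ?P 2 \<omega> (star 2 \<eta>)" if "\<eta> \<in> V 2" for \<eta> \<omega>
    using star[unfolded is_hodge_star_def, rule_format, of 2 \<eta>, unfolded three] that by simp_all

  have Ke_V: "Ke e' b' \<in> V 1" and tKe_W: "tKe e' b' \<in> W 2"
    and DKe: "has_deriv ?X real_space (\<lambda>e. K e b') (\<lambda>\<eta>. ?L 1 \<eta> (Ke e' b')) e'"
    and DtKe: "has_deriv ?X real_space (\<lambda>e. K e b') (\<lambda>\<eta>. ?P 1 \<eta> (tKe e' b')) e'"
    if "e' \<in> V 1" "b' \<in> V 2" for e' b'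
    using Ke[OF that] tKe[OF that] unfolding has_fun_deriv_def has_tw_fun_deriv_straight_def by simp_all
  have tKb_W: "tKb e b \<in> W 1"
    and DtKb: "has_deriv ?Y real_space (\<lambda>b. K e b) (\<lambda>\<eta>. ?P 2 \<eta> (tKb e b)) b"
    using tKb[OF e b] unfolding has_tw_fun_deriv_straight_def three by simp_all
  have d_W: "d e' b' \<in> W 2" if "e' \<in> V 1" "b' \<in> V 2" for e' b'
    unfolding d[OF that]
    by (intro subspace_diff subspace_scale sub star1 tKe_W that)
  \<comment> \<open>Turns pairings with \<open>d\<close> into inner products: the star does so by
    definition, and \<open>tKe\<close> and \<open>Ke\<close> represent the same derivative of
    \<open>K\<close>, which is unique.\<close>
  have pairing_d: "?P 1 \<eta> (d e' b') = ?L 1 \<eta> e' - 4 * pi * ?L 1 \<eta> (Ke e' b')"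
    if "e' \<in> V 1" "b' \<in> V 2" "\<eta> \<in> V 1" for e' b' \<eta>
  proof -
    have "d e' b' = star 1 e' + (- (4 * pi)) *\<^sub>R tKe e' b'" using d[OF that(1,2)] by simp
    then have "?P 1 \<eta> (d e' b') = ?P 1 \<eta> (star 1 e' + (- (4 * pi)) *\<^sub>R tKe e' b')"
      by (rule arg_cong)
    also have "\<dots> = ?P 1 \<eta> (star 1 e') + ?P 1 \<eta> ((- (4 * pi)) *\<^sub>R tKe e' b')"
      by (rule poincare_pairing_add_right[OF _ V1[OF that(3)] W2[OF star1(1)[OF that(1)]]
          W2[OF subspace_scale[OF sub(4) tKe_W[OF that(1,2)]]]]) simp
    also have "?P 1 \<eta> ((- (4 * pi)) *\<^sub>R tKe e' b') = - (4 * pi) * ?P 1 \<eta> (tKe e' b')"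
      by (rule poincare_pairing_scaleR_right[OF _ V1[OF that(3)] W2[OF tKe_W[OF that(1,2)]]]) simp
    also have "?P 1 \<eta> (tKe e' b') = ?L 1 \<eta> (Ke e' b')"
      using has_deriv_unique[OF DtKe[OF that(1,2)] DKe[OF that(1,2)], of \<eta>] that const1 by simp
    also have "?P 1 \<eta> (star 1 e') = ?L 1 \<eta> e'" using star1(2)[OF that(1,3)] by simp
    finally show ?thesis by simp
  qed

  \<comment> \<open>Joint derivatives and the inverse change of variables\<close>
  have eb: "(e, b) \<in> fst (prod_space ?X ?Y)" and db: "(d e b, b) \<in> fst (prod_space ?Z ?Y)"
    using e b d_W[OF e b] by (simp_all add: prod_spaces)
  obtain DK where DK: "has_deriv (prod_space ?X ?Y) real_space (\<lambda>(e, b). K e b) DK (e, b)"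
    using K_diff eb unfolding differentiable_map_def by blast
  \<comment> \<open>The straight derivative is used in \<open>e\<close>, to cancel against the term
    with \<open>Ke\<close> in \<open>H\<close>, and the twisted one in \<open>b\<close>, to match
    the claim.\<close>
  have DK_eq: "DK (u, v) = ?L 1 u (Ke e b) + ?P 2 v (tKb e b)" if "u \<in> V 1" "v \<in> V 2" for u v
    by (rule has_deriv_total[OF DK DKe[OF e b] DtKb])
      (simp_all add: that const1 const2 subspace_0 sub)
  obtain k' where k': "has_deriv (prod_space ?X ?Y) ?X (\<lambda>(e, b). Ke e b) k' (e, b)"
    using Ke_diff eb unfolding differentiable_map_def by blast

  let ?\<Phi> = "\<lambda>(e, b). (d e b, b)"
  \<comment> \<open>The derivative of \<Psi> supplies the velocity of \<open>e\<close> when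
    \<open>(d, b)\<close> moves.\<close>
  define \<Psi> where "\<Psi> = inv_into (fst (prod_space ?X ?Y)) ?\<Phi>"
  have bij: "bij_betw ?\<Phi> (fst (prod_space ?X ?Y)) (fst (prod_space ?Z ?Y))"
    and \<Psi>_diff: "differentiable_map (prod_space ?Z ?Y) (prod_space ?X ?Y) \<Psi>"
    using diffeo unfolding diffeomorphism_def \<Psi>_def by blast+
  have \<Psi>_in: "\<Psi> z \<in> fst (prod_space ?X ?Y)" and \<Phi>_\<Psi>: "?\<Phi> (\<Psi> z) = z"
    if "z \<in> fst (prod_space ?Z ?Y)" for z
    using \<Psi>_diff that bij_betw_inv_into_right[OF bij that] unfolding differentiable_map_def \<Psi>_def by blast+
  have \<Psi>_db: "\<Psi> (d e b, b) = (e, b)"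
    using bij_betw_inv_into_left[OF bij eb] by (simp add: \<Psi>_def)
  obtain D\<Psi> where D\<Psi>: "has_deriv (prod_space ?Z ?Y) (prod_space ?X ?Y) \<Psi> D\<Psi> (d e b, b)"
    using \<Psi>_diff db unfolding differentiable_map_def by blast

  \<comment> \<open>The joint derivative of \<open>Hbar\<close>\<close>
  let ?D = "\<lambda>(w, \<beta>). ?P 1 e w / (4 * pi) + (?P 2 \<beta> (star 2 b) / (4 * pi) + ?P 2 \<beta> (tKb e b))"
  \<comment> \<open>Both claims are restrictions of \<open>?D\<close>: to \<open>\<beta> = 0\<close>
    for the derivative in \<open>d\<close> and to \<open>w = 0\<close> for the one in
    \<open>b\<close>.\<close>
  have DH: "has_deriv (prod_space ?Z ?Y) real_space (\<lambda>(d', b'). Hbar d' b') ?D (d e b, b)"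
    unfolding has_deriv_def
  proof (intro conjI ballI allI impI; (elim conjE)?)
    fix u v :: "'a form \<times> 'a form" and r
    assume u: "u \<in> fst (prod_space ?Z ?Y)"
    obtain u1 u2 where u12: "u = (u1, u2)" "u1 \<in> W 2" "u2 \<in> V 2"
      using u by (cases u) (simp add: prod_spaces)
    show "?D u \<in> fst real_space" by (simp add: real_space_def)
    show "?D (r *\<^sub>R u) = r *\<^sub>R ?D u"
      using poincare_pairing_scaleR_right[OF _ V1[OF e] W2[OF u12(2)], of r]
        poincare_pairing_scaleR_left[OF _ V2[OF u12(3)] W1[OF star2(1)[OF b]], of r]
        poincare_pairing_scaleR_left[OF _ V2[OF u12(3)] W1[OF tKb_W], of r]
      by (simp add: u12(1) algebra_simps)
    assume "v \<in> fst (prod_space ?Z ?Y)"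
    then obtain v1 v2 where v12: "v = (v1, v2)" "v1 \<in> W 2" "v2 \<in> V 2"
      by (cases v) (simp add: prod_spaces)
    show "?D (u + v) = ?D u + ?D v"
      using poincare_pairing_add_right[OF _ V1[OF e] W2[OF u12(2)] W2[OF v12(2)]]
        poincare_pairing_add_left[OF _ V2[OF u12(3)] V2[OF v12(3)] W1[OF star2(1)[OF b]]]
        poincare_pairing_add_left[OF _ V2[OF u12(3)] V2[OF v12(3)] W1[OF tKb_W]]
      by (simp add: u12(1) v12(1) add_divide_distrib)
  next
    fix t :: "nat \<Rightarrow> real" and z :: "nat \<Rightarrow> 'a form \<times> 'a form" and z0 :: "'a form \<times> 'a form"
    assume t0: "\<forall>n. t n \<noteq> 0" and t: "t \<longlonglongrightarrow> 0" and z_in: "\<forall>n. z n \<in> fst (prod_space ?Z ?Y)"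
      and z0_in: "z0 \<in> fst (prod_space ?Z ?Y)" and z_lim: "snd (prod_space ?Z ?Y) z z0"
    define w \<beta> where "w n = fst (z n)" and "\<beta> n = snd (z n)" for n
    have w: "w n \<in> W 2" and \<beta>: "\<beta> n \<in> V 2" for n
      using z_in[rule_format, of n] by (cases "z n"; simp add: prod_spaces w_def \<beta>_def)+
    obtain w0 \<beta>0 where z0: "z0 = (w0, \<beta>0)" by (cases z0)
    have w0: "w0 \<in> W 2" and \<beta>0: "\<beta>0 \<in> V 2" using z0_in by (simp_all add: z0 prod_spaces)
    have w_lim: "form_lim M 2 w w0" and \<beta>_lim: "form_lim M 2 \<beta> \<beta>0"
      using z_lim by (simp_all add: z0 prod_spaces w_def[abs_def] \<beta>_def[abs_def])

    \<comment> \<open>\<open>x n\<close> carries the perturbed point back to the variables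
      \<open>(e, b)\<close>. The change of variables keeps \<open>b\<close>, so only the first
      component \<open>en n\<close> is new.\<close>
    define x where "x n = \<Psi> ((d e b, b) + t n *\<^sub>R z n)" for n
    have dbt: "(d e b, b) + t n *\<^sub>R z n = (d e b + t n *\<^sub>R w n, b + t n *\<^sub>R \<beta> n)" for n
      by (cases "z n") (simp add: w_def \<beta>_def)
    have dbt_in: "(d e b, b) + t n *\<^sub>R z n \<in> fst (prod_space ?Z ?Y)" for n
      unfolding dbt prod_spaces spaces
      by (intro conjI subspace_add subspace_scale sub w \<beta> b d_W e)
    define en where "en n = fst (x n)" for n
    have x: "x n = (en n, b + t n *\<^sub>R \<beta> n)" and en: "en n \<in> V 1"
      and d_en: "d (en n) (b + t n *\<^sub>R \<beta> n) = d e b + t n *\<^sub>R w n" for n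
    proof -
      obtain p q where pq: "x n = (p, q)" by (cases "x n")
      have "?\<Phi> (x n) = (d e b + t n *\<^sub>R w n, b + t n *\<^sub>R \<beta> n)"
        using \<Phi>_\<Psi>[OF dbt_in, of n] unfolding x_def dbt .
      then have q: "q = b + t n *\<^sub>R \<beta> n" and dp: "d p q = d e b + t n *\<^sub>R w n"
        unfolding pq prod.case prod.inject by blast+
      have "x n \<in> fst (prod_space ?X ?Y)"
        using \<Psi>_in[OF dbt_in, of n] unfolding x_def .
      then show "x n = (en n, b + t n *\<^sub>R \<beta> n)" "en n \<in> V 1"
        "d (en n) (b + t n *\<^sub>R \<beta> n) = d e b + t n *\<^sub>R w n"
        using dp unfolding en_def pq q by (simp_all add: prod_spaces)
    qed
    define bn where "bn n = b + t n *\<^sub>R \<beta> n" for n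
    have bn: "bn n \<in> V 2" for n unfolding bn_def by (intro subspace_add subspace_scale sub b \<beta>)
    \<comment> \<open>Difference quotients of \<open>e\<close>, whose limit \<open>v0\<close> comes
      from the derivative of \<Psi>. The point \<open>(en n, bn n)\<close> is then
      \<open>(e, b)\<close> moved by \<open>t n\<close> along the converging directions
      \<open>(v n, \<beta> n)\<close>. Hadamard differentiability of \<open>K\<close> and
      \<open>Ke\<close> admits such varying directions; this is the chain rule.\<close>
    define v where "v n = (en n - e) /\<^sub>R t n" for n
    have en_eq: "en n = e + t n *\<^sub>R v n" for n using t0 by (simp add: v_def)
    have v: "v n \<in> V 1" for n unfolding v_def by (intro subspace_diff subspace_scale sub en e)
    define v0 where "v0 = fst (D\<Psi> z0)"
    have v0: "v0 \<in> V 1"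
      using has_deriv_closed[OF D\<Psi> z0_in] by (cases "D\<Psi> z0") (simp add: v0_def prod_spaces)
    have v_lim: "form_lim M 1 v v0"
    proof -
      have "snd (prod_space ?X ?Y) (\<lambda>n. (\<Psi> ((d e b, b) + t n *\<^sub>R z n) - \<Psi> (d e b, b)) /\<^sub>R t n) (D\<Psi> z0)"
        using t0 z_in by (intro has_deriv_lim[OF D\<Psi> _ t _ z0_in z_lim]) simp_all
      then show ?thesis
        unfolding \<Psi>_db x_def[symmetric] prod_spaces by (simp add: en_def[symmetric] v_def[symmetric] v0_def)
    qed
    have ebt: "(e, b) + t n *\<^sub>R (v n, \<beta> n) = (en n, bn n)" for n by (simp add: en_eq bn_def)
    have v\<beta>: "(v n, \<beta> n) \<in> fst (prod_space ?X ?Y)" for n using v \<beta> by (simp add: prod_spaces)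
    have v\<beta>0: "(v0, \<beta>0) \<in> fst (prod_space ?X ?Y)" using v0 \<beta>0 by (simp add: prod_spaces)
    have v\<beta>_lim: "snd (prod_space ?X ?Y) (\<lambda>n. (v n, \<beta> n)) (v0, \<beta>0)"
      using v_lim \<beta>_lim by (simp add: prod_spaces)
    have tn: "t n \<noteq> 0" for n using t0 by blast

    define \<kappa> where "\<kappa> n = (Ke (en n) (bn n) - Ke e b) /\<^sub>R t n" for n
    have Ke_eq: "Ke (en n) (bn n) = Ke e b + t n *\<^sub>R \<kappa> n" for n using t0 by (simp add: \<kappa>_def)
    have \<kappa>: "\<kappa> n \<in> V 1" for n
      unfolding \<kappa>_def by (intro subspace_diff subspace_scale sub Ke_V en bn e b)
    have \<kappa>0: "k' (v0, \<beta>0) \<in> V 1" using has_deriv_closed[OF k' v\<beta>0] by simp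
    have \<kappa>_lim: "form_lim M 1 \<kappa> (k' (v0, \<beta>0))"
      using has_deriv_lim[OF k' tn t v\<beta> v\<beta>0 v\<beta>_lim] unfolding ebt by (simp add: \<kappa>_def[symmetric])
    have K_lim: "(\<lambda>n. (K (en n) (bn n) - K e b) / t n) \<longlonglongrightarrow> ?L 1 v0 (Ke e b) + ?P 2 \<beta>0 (tKb e b)"
      using has_deriv_lim[OF DK tn t v\<beta> v\<beta>0 v\<beta>_lim] unfolding ebt DK_eq[OF v0 \<beta>0]
      by (simp add: real_space_def divide_inverse_commute)

    \<comment> \<open>An exact identity before any limit: after bilinear expansion, \<open>P\<close>
      below trades \<open>?L 1 e (v n) / (4 * pi) - ?L 1 e (\<kappa> n)\<close> for the pairing of
      \<open>e\<close> with \<open>w n\<close>. The second-order terms keep a factor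
      \<open>t n\<close>.\<close>
    have quotient: "(H (en n) (bn n) - H e b) / t n =
        (K (en n) (bn n) - K e b) / t n - ?L 1 (v n) (Ke e b) + ?P 1 e (w n) / (4 * pi)
        + ?L 2 (\<beta> n) b / (4 * pi)
        + t n * ((?L 1 (v n) (v n) + ?L 2 (\<beta> n) (\<beta> n)) / (8 * pi) - ?L 1 (v n) (\<kappa> n))" for n
    proof -
      \<comment> \<open>Cited by position: 1 to 6 are \<open>e\<close>, \<open>v n\<close>,
        \<open>\<kappa> n\<close>, \<open>Ke e b\<close>, \<open>b\<close>,
        \<open>\<beta> n\<close>; 7 to 9 are the multiples of \<open>v n\<close>,
        \<open>\<kappa> n\<close>, \<open>\<beta> n\<close> by \<open>t n\<close>; 10 and 11 are the
        perturbed \<open>e\<close> and \<open>b\<close>.\<close>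
      note smooth = V1[OF e] V1[OF v] V1[OF \<kappa>] V1[OF Ke_V[OF e b]] V2[OF b] V2[OF \<beta>]
        V1[OF subspace_scale[OF sub(1) v]] V1[OF subspace_scale[OF sub(1) \<kappa>]]
        V2[OF subspace_scale[OF sub(2) \<beta>]]
        V1[OF subspace_add[OF sub(1) e subspace_scale[OF sub(1) v]]]
        V2[OF subspace_add[OF sub(2) b subspace_scale[OF sub(2) \<beta>]]]
      \<comment> \<open>The pairing of \<open>e\<close> with the perturbed \<open>d\<close> is
        evaluated twice: by linearity in \<open>w n\<close>, and by \<open>pairing_d\<close> at both
        points. Comparing the results and cancelling \<open>t n\<close> yields
        \<open>P\<close>.\<close>
      have "?P 1 e (d e b + t n *\<^sub>R w n) = ?P 1 e (d e b) + ?P 1 e (t n *\<^sub>R w n)"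
        by (rule poincare_pairing_add_right[OF _ V1[OF e] W2[OF d_W[OF e b]]
            W2[OF subspace_scale[OF sub(4) w]]]) simp
      also have "?P 1 e (t n *\<^sub>R w n) = t n * ?P 1 e (w n)"
        by (rule poincare_pairing_scaleR_right[OF _ V1[OF e] W2[OF w]]) simp
      finally have "?L 1 e (en n) - 4 * pi * ?L 1 e (Ke (en n) (bn n)) =
          ?L 1 e e - 4 * pi * ?L 1 e (Ke e b) + t n * ?P 1 e (w n)"
        using d_en[of n] pairing_d[OF en bn e, of n n] pairing_d[OF e b e] by (simp add: bn_def)
      moreover have "?L 1 e (en n) = ?L 1 e e + t n * ?L 1 e (v n)"
        unfolding en_eq L2_inner_add_right[OF smooth(1,1,7)] L2_inner_scaleR_right[OF smooth(1,2)] ..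
      moreover have e_Ke: "?L 1 e (Ke (en n) (bn n)) = ?L 1 e (Ke e b) + t n * ?L 1 e (\<kappa> n)"
        unfolding Ke_eq L2_inner_add_right[OF smooth(1,4,8)] L2_inner_scaleR_right[OF smooth(1,3)] ..
      ultimately have "t n * ?P 1 e (w n) = t n * (?L 1 e (v n) - 4 * pi * ?L 1 e (\<kappa> n))"
        by (simp add: algebra_simps)
      then have P: "?P 1 e (w n) = ?L 1 e (v n) - 4 * pi * ?L 1 e (\<kappa> n)" using tn by simp

      have en_Ke: "?L 1 (en n) (Ke (en n) (bn n)) = ?L 1 e (Ke e b) + t n * ?L 1 e (\<kappa> n)
          + t n * ?L 1 (v n) (Ke e b) + t n * t n * ?L 1 (v n) (\<kappa> n)"
        \<comment> \<open>Unfolding \<open>en_eq\<close> also rewrites the \<open>en n\<close>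
          inside \<open>Ke\<close>, so the cited facts are brought to the same form.\<close>
        unfolding en_eq L2_inner_add_left[OF smooth(1,7) V1[OF Ke_V[OF en bn, unfolded en_eq]]]
          e_Ke[unfolded en_eq] L2_inner_scaleR_left[OF smooth(2) V1[OF Ke_V[OF en bn, unfolded en_eq]]]
        unfolding Ke_eq[unfolded en_eq] L2_inner_add_right[OF smooth(2,4,8)]
          L2_inner_scaleR_right[OF smooth(2,3)]
        by (simp add: algebra_simps)
      have en_en: "?L 1 (en n) (en n) = ?L 1 e e + 2 * t n * ?L 1 e (v n) + t n * t n * ?L 1 (v n) (v n)"
        unfolding en_eq L2_inner_add_left[OF smooth(1,7,10)] L2_inner_scaleR_left[OF smooth(2,10)]
          L2_inner_add_right[OF smooth(1,1,7)] L2_inner_add_right[OF smooth(2,1,7)]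
          L2_inner_scaleR_right[OF smooth(1,2)] L2_inner_scaleR_right[OF smooth(2,2)]
          L2_inner_commute[OF smooth(2,1)]
        by (simp add: algebra_simps)
      have bn_bn: "?L 2 (bn n) (bn n) = ?L 2 b b + 2 * t n * ?L 2 (\<beta> n) b + t n * t n * ?L 2 (\<beta> n) (\<beta> n)"
        unfolding bn_def L2_inner_add_left[OF smooth(5,9,11)] L2_inner_scaleR_left[OF smooth(6,11)]
          L2_inner_add_right[OF smooth(5,5,9)] L2_inner_add_right[OF smooth(6,5,9)]
          L2_inner_scaleR_right[OF smooth(5,6)] L2_inner_scaleR_right[OF smooth(6,6)]
          L2_inner_commute[OF smooth(5,6)]
        by (simp add: algebra_simps)
      show ?thesis
        unfolding H[OF en bn] H[OF e b] en_Ke en_en bn_bn P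
        using tn[of n] by (simp add: field_simps)
    qed
    \<comment> \<open>The limit keeps the shape of \<open>quotient\<close>, with 0 for the limit of
      \<open>t n\<close>, so that limit rules apply term by term. The two copies of
      \<open>?L 1 v0 (Ke e b)\<close> cancel afterwards.\<close>
    have H_lim: "(\<lambda>n. (H (en n) (bn n) - H e b) / t n) \<longlonglongrightarrow>
        (?L 1 v0 (Ke e b) + ?P 2 \<beta>0 (tKb e b)) - ?L 1 v0 (Ke e b) + ?P 1 e w0 / (4 * pi)
        + ?L 2 \<beta>0 b / (4 * pi)
        + 0 * ((?L 1 v0 v0 + ?L 2 \<beta>0 \<beta>0) / (8 * pi) - ?L 1 v0 (k' (v0, \<beta>0)))"
      unfolding quotient
    proof (intro tendsto_add tendsto_diff tendsto_mult tendsto_divide tendsto_const K_lim t)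
      show "(\<lambda>n. ?L 1 (v n) (Ke e b)) \<longlonglongrightarrow> ?L 1 v0 (Ke e b)"
        by (rule L2_inner_tendsto[OF V1[OF v] V1[OF v0] V1[OF Ke_V[OF e b]] V1[OF Ke_V[OF e b]]
            v_lim const1[OF Ke_V[OF e b]]])
      show "(\<lambda>n. ?P 1 e (w n)) \<longlonglongrightarrow> ?P 1 e w0"
        using poincare_pairing_tendsto[OF _ V1[OF e] V1[OF e] W2[OF w] W2[OF w0] const1[OF e]] w_lim by simp
      show "(\<lambda>n. ?L 2 (\<beta> n) b) \<longlonglongrightarrow> ?L 2 \<beta>0 b"
        by (rule L2_inner_tendsto[OF V2[OF \<beta>] V2[OF \<beta>0] V2[OF b] V2[OF b] \<beta>_lim const2[OF b]])
      show "(\<lambda>n. ?L 1 (v n) (v n)) \<longlonglongrightarrow> ?L 1 v0 v0"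
        by (rule L2_inner_tendsto[OF V1[OF v] V1[OF v0] V1[OF v] V1[OF v0] v_lim v_lim])
      show "(\<lambda>n. ?L 2 (\<beta> n) (\<beta> n)) \<longlonglongrightarrow> ?L 2 \<beta>0 \<beta>0"
        by (rule L2_inner_tendsto[OF V2[OF \<beta>] V2[OF \<beta>0] V2[OF \<beta>] V2[OF \<beta>0] \<beta>_lim \<beta>_lim])
      show "(\<lambda>n. ?L 1 (v n) (\<kappa> n)) \<longlonglongrightarrow> ?L 1 v0 (k' (v0, \<beta>0))"
        by (rule L2_inner_tendsto[OF V1[OF v] V1[OF v0] V1[OF \<kappa>] V1[OF \<kappa>0] v_lim \<kappa>_lim])
    qed simp_all
    have lim: "(\<lambda>n. (H (en n) (bn n) - H e b) /\<^sub>R t n) \<longlonglongrightarrow> ?D z0"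
    proof (rule tendsto_eq_rhs)
      show "(\<lambda>n. (H (en n) (bn n) - H e b) /\<^sub>R t n) \<longlonglongrightarrow>
          (?L 1 v0 (Ke e b) + ?P 2 \<beta>0 (tKb e b)) - ?L 1 v0 (Ke e b) + ?P 1 e w0 / (4 * pi)
          + ?L 2 \<beta>0 b / (4 * pi)
          + 0 * ((?L 1 v0 v0 + ?L 2 \<beta>0 \<beta>0) / (8 * pi) - ?L 1 v0 (k' (v0, \<beta>0)))"
        using H_lim unfolding real_scaleR_def divide_inverse_commute .
      show "(?L 1 v0 (Ke e b) + ?P 2 \<beta>0 (tKb e b)) - ?L 1 v0 (Ke e b) + ?P 1 e w0 / (4 * pi)
          + ?L 2 \<beta>0 b / (4 * pi)
          + 0 * ((?L 1 v0 v0 + ?L 2 \<beta>0 \<beta>0) / (8 * pi) - ?L 1 v0 (k' (v0, \<beta>0))) = ?D z0"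
        unfolding z0 prod.case star2(2)[OF b \<beta>0] by simp
    qed
    \<comment> \<open>\<open>Hbar\<close> is tied to \<open>H\<close> at values of \<open>d\<close>;
      the perturbed point is one, namely \<open>d (en n) (bn n)\<close>.\<close>
    have Hbar_n: "(\<lambda>(d', b'). Hbar d' b') ((d e b, b) + t n *\<^sub>R z n) = H (en n) (bn n)" for n
      unfolding dbt d_en[symmetric] using Hbar[OF en bn, of n n] by (simp add: bn_def)
    show "snd real_space (\<lambda>n. ((\<lambda>(d', b'). Hbar d' b') ((d e b, b) + t n *\<^sub>R z n) -
        (\<lambda>(d', b'). Hbar d' b') (d e b, b)) /\<^sub>R t n) (?D z0)"
      unfolding Hbar_n prod.case Hbar[OF e b] real_space_def snd_conv by (rule lim)
  qed

  \<comment> \<open>The two partial derivatives of \<open>Hbar\<close> and the relation to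
    \<open>h\<close>\<close>
  have zero: "?P 1 e 0 = 0" "?P 2 0 \<eta> = 0" if "\<eta> \<in> W 1" for \<eta>
    using poincare_pairing_scaleR_right[OF _ V1[OF e] W2[OF subspace_0[OF sub(4)]], of 0]
      poincare_pairing_scaleR_left[OF _ V2[OF subspace_0[OF sub(2)]] W1[OF that], of 0] by simp_all
  have "has_deriv ?Z real_space (\<lambda>d'. Hbar d' b) (\<lambda>w. ?D (w, 0)) (d e b)"
    by (rule has_deriv_partial_fst[OF DH]) (simp_all add: subspace_0 sub const2)
  then have "has_deriv ?Z real_space (\<lambda>d'. Hbar d' b) (\<lambda>w. ?P (3 - 2) (e /\<^sub>R (4 * pi)) w) (d e b)"
  proof (rule has_deriv_cong)
    fix w assume "w \<in> fst ?Z"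
    then have "w \<in> W 2" by simp
    from poincare_pairing_scaleR_left[OF _ V1[OF e] W2[OF this], of "inverse (4 * pi)"]
    show "?D (w, 0) = ?P (3 - 2) (e /\<^sub>R (4 * pi)) w"
      unfolding three using zero(2)[OF star2(1)[OF b]] zero(2)[OF tKb_W] by (simp add: field_simps)
  qed (simp add: sub)
  moreover have "e /\<^sub>R (4 * pi) \<in> V (3 - 2)"
    unfolding three by (rule subspace_scale[OF sub(1) e])
  ultimately have fst_deriv: "has_tw_fun_deriv_twisted M V W 2 (\<lambda>d'. Hbar d' b) (e /\<^sub>R (4 * pi)) (d e b)"
    unfolding has_tw_fun_deriv_twisted_def by blast

  \<comment> \<open>Fixed \<open>d\<close> means \<open>w = 0\<close>: the pairing with
    \<open>e\<close> drops out, although \<open>e\<close> itself may move with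
    \<open>b\<close>.\<close>
  have "has_deriv ?Y real_space (\<lambda>b'. Hbar (d e b) b') (\<lambda>\<beta>. ?D (0, \<beta>)) b"
    by (rule has_deriv_partial_snd[OF DH]) (simp_all add: subspace_0 sub const2')
  then have "has_deriv ?Y real_space (\<lambda>b'. Hbar (d e b) b') (\<lambda>\<beta>. ?P 2 \<beta> (star 2 b /\<^sub>R (4 * pi) + tKb e b)) b"
  proof (rule has_deriv_cong)
    fix \<beta> assume "\<beta> \<in> fst ?Y"
    then have \<beta>: "\<beta> \<in> V 2" by simp
    have "?P 2 \<beta> (star 2 b /\<^sub>R (4 * pi) + tKb e b) = ?P 2 \<beta> (star 2 b /\<^sub>R (4 * pi)) + ?P 2 \<beta> (tKb e b)"
      by (rule poincare_pairing_add_right[OF _ V2[OF \<beta>] W1[OF subspace_scale[OF sub(3) star2(1)[OF b]]]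
          W1[OF tKb_W]]) simp
    also have "?P 2 \<beta> (star 2 b /\<^sub>R (4 * pi)) = inverse (4 * pi) * ?P 2 \<beta> (star 2 b)"
      by (rule poincare_pairing_scaleR_right[OF _ V2[OF \<beta>] W1[OF star2(1)[OF b]]]) simp
    finally show "?D (0, \<beta>) = ?P 2 \<beta> (star 2 b /\<^sub>R (4 * pi) + tKb e b)"
      using zero(1)[OF tKb_W] by (simp add: field_simps)
  qed (simp add: sub)
  moreover have "star 2 b /\<^sub>R (4 * pi) + tKb e b \<in> W (3 - 2)"
    unfolding three by (rule subspace_add[OF sub(3) subspace_scale[OF sub(3) star2(1)[OF b]] tKb_W])
  ultimately have snd_deriv: "has_tw_fun_deriv_straight M V W 2 (\<lambda>b'. Hbar (d e b) b')
      (star 2 b /\<^sub>R (4 * pi) + tKb e b) b"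
    unfolding has_tw_fun_deriv_straight_def by blast

  have "star 2 b /\<^sub>R (4 * pi) + tKb e b = h e b /\<^sub>R (4 * pi)"
    unfolding h[OF e b] by (simp add: scaleR_add_right)
  with fst_deriv snd_deriv show ?thesis by blast
qed

end
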